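(* Let $M=p^2q$ where $p,q$ are distinct primes, and let $\mathcal{A},\mathcal{B}\subset\{0,1,\dots,M-1\}$ with $1<|\mathcal{A}|=|\mathcal{B}|<M$. Suppose that $(\mathcal{A},\mathcal{B})$ is a distributed spectral pair in $\mathbb{Z}_M$. Then it has to be one of the following cases: (1) $(\mathcal{A},\mathcal{B})$ is a spectral pair in $\mathbb{Z}_M$; (2) $p=2$, $q=3$ and $(\mathcal{A},\mathcal{B})$ is a spectral pair in $\mathbb{Z}_{M^2}$. Moreover, $\mathcal{A}=\{0,8\}$ and $\mathcal{B}=\{0,9\}$ after translations.
   Context: For a nonempty finite set $E\subset\mathbb{R}$, put $\widehat{\nu_E}(\xi)=\frac{1}{|E|}\sum_{a\in E}e^{-2\pi i\xi a}$ for $\xi\in\mathbb{R}$. Spectral pair: for an integer $N\ge 1$, $(\mathcal{A},\mathcal{B})$ with $|\mathcal{A}|=|\mathcal{B}|$ is a spectral pair in $\mathbb{Z}_N$ if the matrix $\frac{1}{\sqrt{|\mathcal{A}|}}\left(e^{2\pi i ab/N}\right)_{a\in\mathcal{A},b\in\mathcal{B}}$ is unitary. Distributed spectral pair: $(\mathcal{A},\mathcal{B})$ with $|\mathcal{A}|=|\mathcal{B}|$ is a distributed spectral pair in $\mathbb{Z}_M$ if for all $b_1\neq b_1'$ in $\mathcal{B}$, either $\widehat{\nu_{\mathcal{A}}}\left(\frac{b_1-b_1'}{M}\right)=0$, or $\widehat{\nu_{\mathcal{A}}}\left(\frac{b_1-b_1'}{M^2}+\frac{b_2-b_2'}{M}\right)=0$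 for all $b_2,b_2'\in\mathcal{B}$.
   Formalization: Case (2) is proved up to exchanging the sets: A={0,8}, B={0,9} or A={0,9}, B={0,8} after translations. As printed the claim fails: for M=12, A={0,9}, B={0,8} is a distributed spectral pair, is not spectral in Z_12, and A is not a translate of {0,8}. *)

theory Defs
  imports "HOL-Analysis.Analysis" "HOL-Computational_Algebra.Primes"
begin

definition nu_hat :: "real set \<Rightarrow> real \<Rightarrow> complex" where
  "nu_hat E \<xi> =
     (1 / of_nat (card E)) * (\<Sum>a\<in>E. exp (- (2 * of_real pi * \<i> * of_real \<xi> * of_real a)))"

text \<open>Unitarity of a matrix whose rows and columns are indexed by two finite sets:
  the two clauses say that $U U^*$ and $U^* U$ are the identity matrices.\<close>

definition unitary_on :: "'a set \<Rightarrow> 'b set \<Rightarrow> ('a \<Rightarrow> 'b \<Rightarrow> complex) \<Rightarrow> bool" where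
  "unitary_on A B U \<longleftrightarrow>
     (\<forall>a\<in>A. \<forall>a'\<in>A. (\<Sum>b\<in>B. U a b * cnj (U a' b)) = (if a = a' then 1 else 0)) \<and>
     (\<forall>b\<in>B. \<forall>b'\<in>B. (\<Sum>a\<in>A. cnj (U a b) * U a b') = (if b = b' then 1 else 0))"

text \<open>Elements of $\mathbb{Z}_N$ are represented by integers; the matrix below depends only on
  the residues modulo \<open>N\<close>, and unitarity forces distinct elements to be incongruent.\<close>

definition spectral_pair :: "nat \<Rightarrow> int set \<Rightarrow> int set \<Rightarrow> bool" where
  "spectral_pair N A B \<longleftrightarrow>
     N \<ge> 1 \<and> finite A \<and> finite B \<and> card A = card B \<and>
     unitary_on A B (\<lambda>a b. (1 / of_real (sqrt (real (card A)))) *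
        exp (2 * of_real pi * \<i> * of_int a * of_int b / of_nat N))"

definition distributed_spectral_pair :: "nat \<Rightarrow> int set \<Rightarrow> int set \<Rightarrow> bool" where
  "distributed_spectral_pair M A B \<longleftrightarrow>
     finite A \<and> finite B \<and> card A = card B \<and>
     (\<forall>b1\<in>B. \<forall>b1'\<in>B. b1 \<noteq> b1' \<longrightarrow>
        nu_hat (real_of_int ` A) (real_of_int (b1 - b1') / real M) = 0 \<or>
        (\<forall>b2\<in>B. \<forall>b2'\<in>B.
           nu_hat (real_of_int ` A)
             (real_of_int (b1 - b1') / (real M)\<^sup>2 + real_of_int (b2 - b2') / real M) = 0))"

text \<open>Translates in the integers, without reduction modulo \<open>N\<close>. Case (2) of the theorem is
  symmetric: for \<open>M = 12\<close> both orderings of \<open>{0, 8}\<close> and \<open>{0, 9}\<close> give distributed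
  spectral pairs that are not spectral in $\mathbb{Z}_{12}$ (as \<open>8 * 9 = 144 / 2\<close>).\<close>

definition translate_of :: "int set \<Rightarrow> int set \<Rightarrow> bool" where
  "translate_of A C \<longleftrightarrow> (\<exists>t. A = (\<lambda>x. x + t) ` C)"

end

theory Submission
  imports Defs "HOL-Number_Theory.Cong"
begin

text \<open>Whether a set \<open>A\<close> has a vanishing exponential sum at a frequency depends only on the
  order of that frequency in lowest terms: the sum is a polynomial in a root of unity with integer
  coefficients, so it vanishes at all primitive roots of the same order at once
  (\<open>sum_roots_of_unity_galois\<close>, \<open>vanishes_at_order_iff\<close>). If \<open>n\<close> has at most two distinct
  prime factors and \<open>A\<close>, a proper subset of \<open>{0..<n}\<close>, vanishes at order \<open>n\<close>, then every point
  of \<open>A\<close> lies in a full coset of the subgroup of prime order \<open>r\<close> of the integers modulo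
  \<open>n\<close>, for one of these primes (\<open>vanishing_contains_cycle\<close>). Such a coset is
  spread evenly around the circle, so it does not fit into an interval that is much shorter than
  \<open>n\<close>: if \<open>A\<close> lies in \<open>{0..<L}\<close> with \<open>L < n\<close>, then \<open>(r - 1) * (n div r) < L\<close>,
  and in particular \<open>n < 2 * L\<close> (\<open>vanishing_order_less\<close>).

  Suppose that the pair is not spectral modulo \<open>M\<close>. Then some difference \<open>d\<close> of \<open>B\<close> fails
  the first alternative in the definition of a distributed pair, so \<open>A\<close> vanishes at every frequency
  \<open>d / M\<^sup>2 + e / M\<close> with \<open>e\<close> in \<open>B - B\<close>. For \<open>e = 0\<close> the order is
  \<open>M\<^sup>2 / gcd d (M\<^sup>2)\<close>, which exceeds \<open>M\<close> because \<open>d < M\<close>. It divides \<open>p\<^sup>4 q\<^sup>2\<close>, and the length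
  bound leaves only two possibilities (\<open>bad_difference_cases\<close>): order \<open>18\<close> with \<open>M = 12\<close> and
  \<open>d = 8\<close>, or order \<open>p\<^sup>4\<close> with \<open>d = q\<^sup>2\<close>. In both, the frequencies with \<open>e \<noteq> 0\<close> would usually have an order
  that the length bound excludes. This restricts the differences of \<open>B\<close> so severely that \<open>B\<close>
  has two elements; then \<open>A\<close> has two elements too and is a single coset, which forces
  \<open>M = 12\<close> and gives the two translates of \<open>{0, 8}\<close> and \<open>{0, 9}\<close>
  (\<open>modulus_twelve_case\<close>, \<open>square_difference_case\<close>).\<close>

section \<open>Galois conjugates of a vanishing sum of roots of unity\<close>

text \<open>The ring generated by \<open>z\<close> over the integers, presented as an additive group. For a root of
  unity it is finitely generated as an additive group, which is what limits divisibility below.\<close>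

inductive_set int_span :: "complex \<Rightarrow> complex set" for z where
  pow: "z ^ i \<in> int_span z"
| add: "x \<in> int_span z \<Longrightarrow> y \<in> int_span z \<Longrightarrow> x + y \<in> int_span z"
| uminus: "x \<in> int_span z \<Longrightarrow> - x \<in> int_span z"

lemma int_span_0: "0 \<in> int_span z"
  using add[OF pow uminus[OF pow], of z 0 0] by simp

lemma int_span_1: "1 \<in> int_span z"
  using pow[of z 0] by simp

lemma int_span_sum: "(\<And>i. i \<in> I \<Longrightarrow> f i \<in> int_span z) \<Longrightarrow> sum f I \<in> int_span z"
  by (induction I rule: infinite_finite_induct) (auto intro: int_span_0 add)

lemma int_span_mult:
  assumes "x \<in> int_span z" "y \<in> int_span z"
  shows "x * y \<in> int_span z"
  using assms(1)
proof induction
  case (pow i)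
  show ?case using assms(2)
  proof induction
    case (pow j)
    then show ?case by (metis int_span.pow power_add)
  qed (auto simp: distrib_left intro: int_span.intros)
qed (auto simp: distrib_right intro: int_span.intros)

lemma int_span_of_nat: "of_nat k \<in> int_span z"
  by (induction k) (auto intro: int_span_0 int_span_1 add)

lemma int_span_power: "x \<in> int_span z \<Longrightarrow> x ^ k \<in> int_span z"
  by (induction k) (auto intro: int_span_1 int_span_mult)

text \<open>A linear functional on the complex numbers seen as a vector space over the rationals. It
  transports divisibility statements from a ring of algebraic numbers to the rationals.\<close>

lemma exists_additive_functional:
  fixes \<alpha> :: complex
  assumes "\<alpha> \<noteq> 0"
  obtains f :: "complex \<Rightarrow> rat" where "\<And>x y. f (x + y) = f x + f y" "f \<alpha> = 1"
proof -
  interpret vector_space_pair "\<lambda>(c::rat) (x::complex). of_rat c * x" "(*) :: rat \<Rightarrow> rat \<Rightarrow> rat"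
    by unfold_locales (auto simp: algebra_simps of_rat_add of_rat_mult)
  have "vs1.independent {\<alpha>}"
    using assms by simp
  from linear_independent_extend[OF this, of "\<lambda>_. 1"] obtain f where
    "Vector_Spaces.linear (\<lambda>(c::rat) (x::complex). of_rat c * x) (*) f" "f \<alpha> = 1"
    by auto
  then show ?thesis using that by (metis Vector_Spaces.linear.axioms(3) module_hom.add Vector_Spaces.linear_def)
qed

text \<open>A functional \<open>f\<close> with \<open>f \<alpha> = 1\<close> maps the finitely many powers of \<open>z\<close>, hence the whole ring, to
  rationals with a common denominator \<open>D\<close>. If \<open>\<alpha> = r * \<beta>\<close>, then \<open>D = r * (D * f \<beta>)\<close> is a
  multiple of \<open>r\<close>.\<close>

lemma int_span_finitely_many_divisors:
  assumes "z ^ n = 1" "n > 0" "\<alpha> \<noteq> 0"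
  obtains D :: nat where "D > 0"
    "\<And>r \<beta>. \<beta> \<in> int_span z \<Longrightarrow> \<alpha> = of_nat r * \<beta> \<Longrightarrow> r dvd D"
proof -
  obtain f :: "complex \<Rightarrow> rat" where f: "\<And>x y. f (x + y) = f x + f y" "f \<alpha> = 1"
    using exists_additive_functional[OF assms(3)] by blast
  have f0: "f 0 = 0" using f(1)[of 0 0] by simp
  have fu: "f (- x) = - f x" for x using f(1)[of x "- x"] f0 by simp
  have fm: "f (of_nat k * x) = of_nat k * f x" for k x
    by (induction k) (auto simp: f0 f(1) algebra_simps)
  define d where "d x = snd (quotient_of (f x))" for x
  define D where "D = (\<Prod>j<n. d (z ^ j))"
  have dpos: "d x > 0" for x unfolding d_def by (simp add: quotient_of_denom_pos')
  have dint: "of_int (d x) * f x \<in> \<int>" for x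
  proof -
    have "f x = of_int (fst (quotient_of (f x))) / of_int (d x)"
      unfolding d_def by (simp add: quotient_of_div)
    then show ?thesis using dpos[of x] by (metis Ints_of_int less_irrefl nonzero_mult_div_cancel_left of_int_eq_0_iff times_divide_eq_right)
  qed
  have Dpos: "D > 0" unfolding D_def by (intro prod_pos) (auto simp: dpos)
  have Dint: "of_int D * f \<beta> \<in> \<int>" if "\<beta> \<in> int_span z" for \<beta>
    using that
  proof induction
    case (pow i)
    have "z ^ i = z ^ (n * (i div n) + i mod n)" by simp
    also have "\<dots> = z ^ (i mod n)"
      by (simp only: power_add power_mult assms(1)) simp
    finally have e: "z ^ i = z ^ (i mod n)" .
    have "d (z ^ (i mod n)) dvd D" unfolding D_def using assms(2)
      by (intro dvd_prodI) auto
    then obtain c where "D = d (z ^ (i mod n)) * c" by blast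
    then have "of_int D * f (z ^ i) = of_int c * (of_int (d (z ^ (i mod n))) * f (z ^ (i mod n)))"
      unfolding e by simp
    then show ?case using dint by (metis Ints_mult Ints_of_int)
  qed (auto simp: f(1) fu distrib_left)
  show ?thesis
  proof (rule that[of "nat D"])
    fix r \<beta> assume b: "\<beta> \<in> int_span z" "\<alpha> = of_nat r * \<beta>"
    obtain c where "of_int D * f \<beta> = of_int c" using Dint[OF b(1)] by (auto elim: Ints_cases)
    moreover have "1 = of_nat r * f \<beta>" using f(2) fm b(2) by metis
    ultimately have "(of_int D :: rat) = of_nat r * of_int c"
      by (metis mult.left_commute mult.right_neutral)
    then have "D = int r * c" by (metis of_int_eq_iff of_int_mult of_int_of_nat_eq)
    then show "r dvd nat D" using Dpos by (metis dvd_triv_left int_dvd_int_iff int_nat_eq less_le)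
  qed (use Dpos in auto)
qed

lemma freshmans_dream_int_span:
  assumes "prime r" "x \<in> int_span z" "y \<in> int_span z"
  shows "\<exists>\<beta>\<in>int_span z. (x + y) ^ r = x ^ r + y ^ r + of_nat r * \<beta>"
proof -
  have r: "r > 0" using assms(1) prime_gt_0_nat by blast
  define \<beta> where "\<beta> = (\<Sum>k\<in>{1..<r}. of_nat ((r choose k) div r) * x ^ k * y ^ (r - k))"
  have "(x + y) ^ r = (\<Sum>k\<le>r. of_nat (r choose k) * x ^ k * y ^ (r - k))"
    by (rule binomial_ring)
  also have "{..r} = insert 0 (insert r {1..<r})" using r by auto
  also have "(\<Sum>k\<in>insert 0 (insert r {1..<r}). of_nat (r choose k) * x ^ k * y ^ (r - k))
     = x ^ r + y ^ r + (\<Sum>k\<in>{1..<r}. of_nat (r choose k) * x ^ k * y ^ (r - k))"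
    using r by simp
  also have "(\<Sum>k\<in>{1..<r}. of_nat (r choose k) * x ^ k * y ^ (r - k)) = of_nat r * \<beta>"
    unfolding \<beta>_def sum_distrib_left
  proof (rule sum.cong[OF refl])
    fix k assume "k \<in> {1..<r}"
    then have "r dvd (r choose k)" using assms(1) by (intro dvd_choose_prime) auto
    then have "(of_nat (r choose k) :: complex) = of_nat r * of_nat ((r choose k) div r)"
      by (metis dvd_mult_div_cancel of_nat_mult)
    then show "of_nat (r choose k) * x ^ k * y ^ (r - k) =
        of_nat r * (of_nat ((r choose k) div r) * x ^ k * y ^ (r - k))" by simp
  qed
  finally have "(x + y) ^ r = x ^ r + y ^ r + of_nat r * \<beta>" .
  moreover have "\<beta> \<in> int_span z" unfolding \<beta>_def
    using assms by (intro int_span_sum int_span_mult int_span_of_nat int_span_power) auto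
  ultimately show ?thesis by blast
qed

lemma freshmans_dream_sum_int_span:
  assumes "prime r" "finite I" "\<And>i. i \<in> I \<Longrightarrow> g i \<in> int_span z"
  shows "\<exists>\<beta>\<in>int_span z. (\<Sum>i\<in>I. g i) ^ r = (\<Sum>i\<in>I. g i ^ r) + of_nat r * \<beta>"
  using assms(2,3)
proof (induction I rule: finite_induct)
  case empty
  then show ?case using prime_gt_0_nat[OF assms(1)] by (auto intro!: bexI[OF _ int_span_0])
next
  case (insert i I)
  then obtain \<beta> where b: "\<beta> \<in> int_span z" "(\<Sum>i\<in>I. g i) ^ r = (\<Sum>i\<in>I. g i ^ r) + of_nat r * \<beta>"
    by auto
  obtain \<gamma> where c: "\<gamma> \<in> int_span z" "(g i + (\<Sum>i\<in>I. g i)) ^ r = g i ^ r + (\<Sum>i\<in>I. g i) ^ r + of_nat r * \<gamma>"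
    using freshmans_dream_int_span[OF assms(1)] insert int_span_sum[of I g z] by (metis insertCI)
  show ?case using insert(1,2) b c by (intro bexI[of _ "\<beta> + \<gamma>"]) (auto simp: algebra_simps intro: add)
qed

text \<open>Add to \<open>k\<close> the product of \<open>n\<close> and all small primes that do not divide \<open>k\<close>. A small prime then
  divides exactly one of the two summands: those dividing \<open>k\<close> divide neither \<open>n\<close> nor the
  added primes.\<close>

lemma exists_cong_with_large_prime_factors:
  fixes k n N :: nat
  assumes "coprime k n"
  obtains k' where "[k' = k] (mod n)" "\<And>r. prime r \<Longrightarrow> r dvd k' \<Longrightarrow> r > N" "k' > 0"
proof -
  define P where "P = {l. prime l \<and> l \<le> N \<and> \<not> l dvd k}"
  have fin: "finite P" unfolding P_def by auto
  define k' where "k' = k + n * \<Prod>P"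
  have big: "r > N" if r: "prime r" "r dvd k'" for r
  proof (rule ccontr)
    assume le: "\<not> r > N"
    show False
    proof (cases "r dvd k")
      case True
      then have "\<not> r dvd n" using assms r(1) by (meson coprime_common_divisor_nat not_prime_1 coprime_def prime_nat_iff not_prime_unit)
      moreover have "r dvd n * \<Prod>P" using r(2) True unfolding k'_def by (simp add: dvd_add_right_iff)
      ultimately have "r dvd \<Prod>P" using r(1) prime_dvd_mult_iff by blast
      then obtain l where "l \<in> P" "r dvd l" using prime_dvd_prod_iff[OF fin r(1), of "\<lambda>x. x"] by auto
      then show False using True r(1) primes_dvd_imp_eq[of r l] unfolding P_def by auto
    next
      case False
      then have "r \<in> P" using le r(1) unfolding P_def by auto
      then have "r dvd \<Prod>P" using dvd_prodI[OF fin, of r "\<lambda>x. x"] by simp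
      then show False using r(2) False unfolding k'_def by (simp add: dvd_add_left_iff)
    qed
  qed
  have "k' > 0"
  proof (rule ccontr)
    assume "\<not> k' > 0"
    then have "k' = 0" by simp
    obtain r where "prime r" "r > N" using bigger_prime by blast
    have "k = 0 \<and> (n = 0 \<or> \<Prod>P = 0)" using \<open>k' = 0\<close> unfolding k'_def by auto
    moreover have "\<Prod>P \<noteq> 0" using fin unfolding P_def by auto
    ultimately show False using assms by auto
  qed
  moreover have "[k' = k] (mod n)" unfolding k'_def by (simp add: cong_def)
  ultimately show ?thesis using that big by blast
qed

text \<open>This follows Landau's proof of the irreducibility of cyclotomic polynomials. Write
  \<open>F m\<close> for the sum at \<open>z ^ m\<close>. For a prime \<open>r\<close>, \<open>F (r * m)\<close> is congruent to \<open>F m ^ r\<close> modulo \<open>r\<close>, so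
  \<open>F m = 0\<close> makes \<open>F (r * m)\<close> divisible by \<open>r\<close>. Only finitely many nonzero values of \<open>F\<close> occur,
  and none is divisible by a large prime; hence \<open>F (r * m) = 0\<close> when \<open>r\<close> is large. The multiplier
  \<open>k\<close> may be replaced by a congruent one that has only large prime factors.\<close>

lemma sum_roots_of_unity_galois:
  fixes z :: complex and A :: "nat set"
  assumes "z ^ n = 1" "n > 0" "finite A" "coprime k n" "(\<Sum>a\<in>A. z ^ a) = 0"
  shows "(\<Sum>a\<in>A. z ^ (k * a)) = 0"
proof -
  define F where "F j = (\<Sum>a\<in>A. z ^ (j * a))" for j
  have red: "z ^ i = z ^ j" if "[i = j] (mod n)" for i j
  proof -
    have "z ^ i = z ^ (n * (i div n) + i mod n)" "z ^ j = z ^ (n * (j div n) + j mod n)" by simp_all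
    then show ?thesis using that assms(1) by (simp only: power_add power_mult cong_def) simp
  qed
  have Fred: "F i = F j" if "[i = j] (mod n)" for i j
    unfolding F_def using that by (intro sum.cong refl red) (simp add: cong_scalar_right)
  have "\<forall>j. \<exists>D>0. F j \<noteq> 0 \<longrightarrow> (\<forall>r \<beta>. \<beta> \<in> int_span z \<longrightarrow> F j = of_nat r * \<beta> \<longrightarrow> r dvd D)"
    using int_span_finitely_many_divisors[OF assms(1,2)] by (metis zero_less_one)
  then obtain D :: "nat \<Rightarrow> nat" where D: "\<And>j. D j > 0"
    "\<And>j r \<beta>. F j \<noteq> 0 \<Longrightarrow> \<beta> \<in> int_span z \<Longrightarrow> F j = of_nat r * \<beta> \<Longrightarrow> r dvd D j" by metis
  \<comment> \<open>a prime above \<open>N\<close> divides none of the nonzero values of \<open>F\<close>\<close>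
  define N where "N = (\<Sum>j<n. D j)"
  have ND: "D j \<le> N" if "j < n" for j
    unfolding N_def using that by (intro member_le_sum) auto
  obtain k' where k': "[k' = k] (mod n)" "\<And>r. prime r \<Longrightarrow> r dvd k' \<Longrightarrow> r > N" "k' > 0"
    using exists_cong_with_large_prime_factors[OF assms(4)] by metis
  have step: "F (r * m) = 0" if rm: "prime r" "r > N" "F m = 0" for r m
  proof (rule ccontr)
    assume nz: "F (r * m) \<noteq> 0"
    obtain \<beta> where b: "\<beta> \<in> int_span z"
      "(\<Sum>a\<in>A. z ^ (m * a)) ^ r = (\<Sum>a\<in>A. (z ^ (m * a)) ^ r) + of_nat r * \<beta>"
      using freshmans_dream_sum_int_span[OF rm(1) assms(3), of "\<lambda>a. z ^ (m * a)" z]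
      by (auto intro: pow)
    have "F (r * m) = (\<Sum>a\<in>A. (z ^ (m * a)) ^ r)"
      unfolding F_def by (simp add: power_mult[symmetric] mult_ac)
    also have "\<dots> = of_nat r * (- \<beta>)"
      using b(2) rm(3) prime_gt_0_nat[OF rm(1)] unfolding F_def by (simp add: eq_neg_iff_add_eq_0 power_0_left)
    finally have e: "F (r * m) = of_nat r * (- \<beta>)" .
    define j where "j = (r * m) mod n"
    have "F j = F (r * m)" unfolding j_def by (intro Fred) (simp add: cong_def)
    then have "r dvd D j" using D(2)[of j "- \<beta>" r] e nz b(1) by (auto intro: uminus)
    then have "r \<le> D j" using D(1) by (simp add: dvd_imp_le)
    then show False using ND[of j] rm(2) assms(2) unfolding j_def by simp
  qed
  have "F k' = 0" using k'(2,3)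
  proof (induction k' rule: prime_divisors_induct)
    case (unit x)
    then show ?case using assms(5) unfolding F_def by simp
  next
    case (factor p x)
    then have "F x = 0" by (metis dvd_mult mult_0_right not_gr0)
    then show ?case using step[of p x] factor by auto
  qed simp
  then show ?thesis using Fred[OF k'(1)] unfolding F_def by simp
qed

section \<open>Exponential sums of integer sets\<close>

definition unity :: "real \<Rightarrow> complex" where "unity t = cis (2 * pi * t)"

lemma unity_power: "unity t ^ k = unity (real k * t)"
  unfolding unity_def by (simp only: Complex.DeMoivre) (simp add: mult_ac)

lemma unity_of_int: "unity (of_int m) = 1"
  using cis_multiple_2pi[of "of_int m"] by (simp add: unity_def)

lemma unity_add: "unity (s + t) = unity s * unity t"
  by (simp add: unity_def cis_mult distrib_left)

lemma unity_add_of_int: "unity (t + of_int m) = unity t"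
  by (simp only: unity_add unity_of_int mult_1_right)

lemma unity_eq_1_iff: "unity t = 1 \<longleftrightarrow> t \<in> \<int>"
proof
  assume "unity t = 1"
  then have "cos (2 * pi * t) = 1" unfolding unity_def by (metis cis.simps(1) one_complex.simps(1))
  then obtain m :: int where "2 * pi * t = of_int m * 2 * pi" using cos_one_2pi_int by blast
  then have "t = of_int m" by simp
  then show "t \<in> \<int>" by simp
qed (auto elim!: Ints_cases simp only: unity_of_int)

lemma unity_frac_eq_1_iff: "n > 0 \<Longrightarrow> unity (of_int m / real n) = 1 \<longleftrightarrow> int n dvd m"
proof -
  assume n: "n > 0"
  have "of_int m / real n \<in> \<int> \<longleftrightarrow> int n dvd m"
  proof
    assume "of_int m / real n \<in> \<int>"
    then obtain c where "of_int m / real n = of_int c" by (auto elim: Ints_cases)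
    then have "real_of_int m = of_int (int n * c)" using n by (simp add: field_simps)
    then show "int n dvd m" by (metis dvd_triv_left of_int_eq_iff)
  next
    assume "int n dvd m"
    then obtain c where "m = int n * c" by blast
    then show "of_int m / real n \<in> \<int>" using n by simp
  qed
  then show ?thesis by (simp add: unity_eq_1_iff)
qed

lemma sum_unity_multiples:
  assumes "n > 0"
  shows "(\<Sum>k<n. unity (of_int (int k * m) / real n)) = (if int n dvd m then of_nat n else 0)"
proof -
  define w where "w = unity (of_int m / real n)"
  have w: "unity (of_int (int k * m) / real n) = w ^ k" for k
    unfolding w_def by (simp add: unity_power mult_ac)
  have wn: "w ^ n = 1"
    using assms unity_of_int[of m] unfolding w_def by (simp add: unity_power)
  show ?thesis
  proof (cases "int n dvd m")
    case True
    then have "w = 1" using unity_frac_eq_1_iff[OF assms] w_def by simp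
    then show ?thesis using True by (simp only: w) simp
  next
    case False
    then have "w \<noteq> 1" using unity_frac_eq_1_iff[OF assms] w_def by simp
    then show ?thesis using False wn geometric_sum[of w n] by (simp only: w if_False) simp
  qed
qed

definition exp_sum :: "int set \<Rightarrow> real \<Rightarrow> complex" where
  "exp_sum A t = (\<Sum>a\<in>A. unity (t * of_int a))"

lemma exp_sum_add_of_int: "exp_sum A (t + of_int m) = exp_sum A t"
  unfolding exp_sum_def
proof (rule sum.cong[OF refl])
  fix a assume "a \<in> A"
  show "unity ((t + of_int m) * of_int a) = unity (t * of_int a)"
    using unity_add_of_int[of "t * of_int a" "m * a"] by (simp add: algebra_simps)
qed

text \<open>The Laurent polynomial with exponent set \<open>A\<close> vanishes at all primitive roots of unity of order \<open>n\<close>, that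
  is, it is divisible by the \<open>n\<close>-th cyclotomic polynomial.\<close>

definition vanishes_at_order :: "int set \<Rightarrow> nat \<Rightarrow> bool" where
  "vanishes_at_order A n \<longleftrightarrow> (\<forall>j. coprime j (int n) \<longrightarrow> exp_sum A (of_int j / real n) = 0)"

lemma vanishes_at_order_iff:
  assumes "finite A" "A \<subseteq> {0..}" "n > 0" "coprime m (int n)"
  shows "exp_sum A (of_int m / real n) = 0 \<longleftrightarrow> vanishes_at_order A n"
proof -
  have "exp_sum A (of_int j / real n) = 0"
    if z: "exp_sum A (of_int m / real n) = 0" and j: "coprime j (int n)" for j
  proof -
    obtain i where i: "[m * i = 1] (mod int n)" using assms(4) cong_solve_coprime_int by blast
    define k where "k = nat ((i * j) mod int n)"
    have ki: "int k = (i * j) mod int n" unfolding k_def using assms(3) by simp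
    have "[int k = i * j] (mod int n)" unfolding ki by simp
    then have "[m * int k = m * (i * j)] (mod int n)" by (rule cong_scalar_left)
    moreover have "[m * i * j = 1 * j] (mod int n)" using i by (rule cong_scalar_right)
    ultimately have mk: "[m * int k = j] (mod int n)" by (simp add: mult.assoc) (metis cong_trans)
    then have "coprime (m * int k) (int n)" using j by (metis cong_imp_coprime cong_sym)
    then have kc: "coprime k n" by simp
    define z where "z = unity (of_int m / real n)"
    have zn: "z ^ n = 1" using assms(3) unity_of_int[of m] unfolding z_def by (simp add: unity_power)
    have inj: "inj_on nat A" using assms(2) by (intro inj_onI) (metis atLeast_iff nat_eq_iff subsetD)
    have za: "(\<Sum>a\<in>nat ` A. z ^ (l * a)) = exp_sum A (of_int (int l * m) / real n)" for l
      unfolding exp_sum_def sum.reindex[OF inj] o_def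
    proof (rule sum.cong[OF refl])
      fix a assume "a \<in> A"
      then have "real (nat a) = of_int a" using assms(2) by auto
      then show "z ^ (l * nat a) = unity (of_int (int l * m) / real n * of_int a)"
        unfolding z_def by (simp add: unity_power mult_ac)
    qed
    have "(\<Sum>a\<in>nat ` A. z ^ (k * a)) = 0"
      using za[of 1] z assms(1) by (intro sum_roots_of_unity_galois[OF zn assms(3) _ kc]) auto
    then have "exp_sum A (of_int (int k * m) / real n) = 0" using za by simp
    moreover obtain c where "j = int k * m + int n * c"
      using mk cong_sym by (metis cong_iff_lin mult.commute)
    ultimately show ?thesis
      using exp_sum_add_of_int[of A "of_int (int k * m) / real n" c] assms(3) by (simp add: add_divide_distrib)
  qed
  then show ?thesis unfolding vanishes_at_order_def using assms(4) by blast
qed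

lemma exp_sum_lowest_terms:
  assumes "finite A" "A \<subseteq> {0..}" "n > 0" "coprime m (int n)" "exp_sum A t = 0"
    and "t * real n = of_int m"
  shows "vanishes_at_order A n"
proof -
  have "t = of_int m / real n" using assms(3,6) by (simp add: field_simps)
  then show ?thesis using vanishes_at_order_iff assms(1-5) by blast
qed

lemma vanishes_at_orderD:
  assumes "vanishes_at_order A n" "n > 0" "coprime m (int n)" "t * real n = of_int m"
  shows "exp_sum A t = 0"
proof -
  have "t = of_int m / real n" using assms(2,4) by (simp add: field_simps)
  then show ?thesis using assms(1,3) unfolding vanishes_at_order_def by blast
qed

section \<open>Cycles in sets with vanishing exponential sums\<close>

text \<open>The indicator function of \<open>A\<close> modulo \<open>n\<close> has a Fourier transform supported on frequencies
  that are not coprime to \<open>n\<close>. The mixed difference \<open>ind x - ind (x + u) - ind (x + v) + ind (x + u + v)\<close>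
  multiplies it by \<open>(1 - U) * (1 - V)\<close>, and the hypothesis on \<open>u\<close> and \<open>v\<close> makes one of these factors
  vanish at the remaining frequencies. So the mixed difference is zero; if \<open>ind x = 1\<close> and both
  \<open>ind (x + u)\<close> and \<open>ind (x + v)\<close> were zero, it would be positive.\<close>

lemma exchange:
  assumes "n > 0" "A \<subseteq> {0..<int n}" "vanishes_at_order A n" "x \<in> A"
    and uv: "\<And>k. \<not> coprime k (int n) \<Longrightarrow> int n dvd k * u \<or> int n dvd k * v"
  shows "(x + u) mod int n \<in> A \<or> (x + v) mod int n \<in> A"
proof (rule ccontr)
  assume neg: "\<not> ?thesis"
  have fin: "finite A" using assms(2) finite_subset by blast
  define ind :: "int \<Rightarrow> complex" where "ind y = (if y mod int n \<in> A then 1 else 0)" for y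
  \<comment> \<open>Fourier inversion on the integers modulo \<open>n\<close>\<close>
  have inv: "of_nat n * ind y = (\<Sum>k<n. exp_sum A (real k / real n) * unity (- of_int (int k * y) / real n))" for y
  proof -
    have "(\<Sum>k<n. exp_sum A (real k / real n) * unity (- of_int (int k * y) / real n))
      = (\<Sum>k<n. \<Sum>a\<in>A. unity (of_int (int k * (a - y)) / real n))"
      unfolding exp_sum_def sum_distrib_right
    proof (intro sum.cong refl)
      fix k a
      have "real k / real n * of_int a + - of_int (int k * y) / real n = of_int (int k * (a - y)) / real n"
        by (simp add: right_diff_distrib diff_divide_distrib)
      then show "unity (real k / real n * of_int a) * unity (- of_int (int k * y) / real n)
        = unity (of_int (int k * (a - y)) / real n)" by (simp only: unity_add[symmetric])
    qed
    also have "\<dots> = (\<Sum>a\<in>A. \<Sum>k<n. unity (of_int (int k * (a - y)) / real n))"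
      by (rule sum.swap)
    also have "\<dots> = (\<Sum>a\<in>A. if a = y mod int n then of_nat n else 0)"
    proof (rule sum.cong[OF refl])
      fix a assume "a \<in> A"
      then have "a mod int n = a" using assms(2) by auto
      then have "int n dvd (a - y) \<longleftrightarrow> a = y mod int n" by (simp add: mod_eq_dvd_iff[symmetric])
      then show "(\<Sum>k<n. unity (of_int (int k * (a - y)) / real n)) = (if a = y mod int n then of_nat n else 0)"
        by (simp only: sum_unity_multiples[OF assms(1)])
    qed
    also have "\<dots> = of_nat n * ind y" unfolding ind_def using fin by simp
    finally show ?thesis by simp
  qed
  have term0: "exp_sum A (real k / real n) *
      (unity (- of_int (int k * x) / real n) - unity (- of_int (int k * (x + u)) / real n)
       - unity (- of_int (int k * (x + v)) / real n) + unity (- of_int (int k * (x + u + v)) / real n)) = 0" for k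
  proof -
    define U where "U = unity (of_int (int k * - u) / real n)"
    define V where "V = unity (of_int (int k * - v) / real n)"
    define X where "X = unity (of_int (int k * - x) / real n)"
    have "unity (- of_int (int k * x) / real n) = X"
      "unity (- of_int (int k * (x + u)) / real n) = X * U"
      "unity (- of_int (int k * (x + v)) / real n) = X * V"
      "unity (- of_int (int k * (x + u + v)) / real n) = X * U * V"
      unfolding U_def V_def X_def unity_add[symmetric]
      by (simp_all add: algebra_simps diff_divide_distrib add_divide_distrib)
    then have "unity (- of_int (int k * x) / real n) - unity (- of_int (int k * (x + u)) / real n)
       - unity (- of_int (int k * (x + v)) / real n) + unity (- of_int (int k * (x + u + v)) / real n)
       = X * (1 - U) * (1 - V)" by (simp only:) (simp add: algebra_simps)
    moreover have "exp_sum A (real k / real n) = 0 \<or> U = 1 \<or> V = 1"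
    proof (cases "coprime (int k) (int n)")
      case True
      then have "exp_sum A (of_int (int k) / real n) = 0"
        using assms(3) unfolding vanishes_at_order_def by blast
      then show ?thesis by simp
    next
      case False
      from uv[OF this] have "int n dvd int k * - u \<or> int n dvd int k * - v" by simp
      then show ?thesis unfolding U_def V_def using unity_frac_eq_1_iff[OF assms(1)] by blast
    qed
    ultimately show ?thesis by auto
  qed
  have "of_nat n * (ind x - ind (x + u) - ind (x + v) + ind (x + u + v))
    = (\<Sum>k<n. exp_sum A (real k / real n) *
      (unity (- of_int (int k * x) / real n) - unity (- of_int (int k * (x + u)) / real n)
       - unity (- of_int (int k * (x + v)) / real n) + unity (- of_int (int k * (x + u + v)) / real n)))"
    by (simp only: distrib_left right_diff_distrib inv sum.distrib sum_subtractf)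
  also have "\<dots> = 0" by (simp only: term0) simp
  finally have "ind x - ind (x + u) - ind (x + v) + ind (x + u + v) = 0" using assms(1) by simp
  moreover have "ind x = 1" using assms(2,4) unfolding ind_def by auto
  moreover have "ind (x + u) = 0" "ind (x + v) = 0" using neg unfolding ind_def by auto
  ultimately show False unfolding ind_def by (auto split: if_splits)
qed

text \<open>For \<open>r\<close> dividing \<open>n\<close>, the points run through the coset of \<open>x\<close> by the subgroup of order \<open>r\<close> of the
  integers modulo \<open>n\<close>, with representatives in \<open>{0..<n}\<close>.\<close>

definition contains_cycle :: "nat \<Rightarrow> nat \<Rightarrow> int set \<Rightarrow> int \<Rightarrow> bool" where
  "contains_cycle n r A x \<longleftrightarrow> (\<forall>i. (x + i * int (n div r)) mod int n \<in> A)"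

lemma multiple_of_cycle_step:
  fixes n r :: nat
  assumes "r dvd n" "int r dvd k"
  shows "int n dvd k * (i * int (n div r))"
proof -
  obtain c where "k = int r * c" using assms(2) by blast
  moreover have "int r * int (n div r) = int n" using assms(1) by (metis dvd_mult_div_cancel of_nat_mult)
  ultimately have "k * (i * int (n div r)) = int n * (c * i)" by (simp only: mult_ac)
  then show ?thesis by (simp only: dvd_triv_left)
qed

lemma not_coprime_prime_factor:
  assumes "\<not> coprime k (int n)" "n > 0"
  obtains r :: nat where "prime r" "r dvd n" "int r dvd k"
proof -
  have "gcd k (int n) \<noteq> 0" "\<not> is_unit (gcd k (int n))"
    using assms by (auto simp: is_unit_gcd)
  then obtain r' where r': "prime r'" "r' dvd gcd k (int n)"
    by (metis prime_divisorE)
  define r where "r = nat r'"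
  have r: "r' = int r" using prime_ge_0_int[OF r'(1)] unfolding r_def by simp
  show ?thesis using r' by (intro that[of r]) (auto simp: r)
qed

text \<open>The two alternatives given by the exchange property hold for each pair of steps separately. A
  step \<open>i\<close> that fails on the side of \<open>p\<close> forces all steps on the side of \<open>q\<close> to succeed.\<close>

lemma cycles_two_primes:
  assumes "p dvd n" "q dvd n" "n > 0" "\<And>r. prime r \<Longrightarrow> r dvd n \<Longrightarrow> r = p \<or> r = q"
    and "A \<subseteq> {0..<int n}" "vanishes_at_order A n" "x \<in> A"
  shows "contains_cycle n p A x \<or> contains_cycle n q A x"
proof -
  have "(x + i * int (n div p)) mod int n \<in> A \<or> (x + j * int (n div q)) mod int n \<in> A" for i j
  proof (rule exchange[OF assms(3,5,6,7)])
    fix k assume "\<not> coprime k (int n)"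
    then obtain r where "prime r" "r dvd n" "int r dvd k" using not_coprime_prime_factor assms(3) by blast
    then show "int n dvd k * (i * int (n div p)) \<or> int n dvd k * (j * int (n div q))"
      using assms(1,2,4) multiple_of_cycle_step by blast
  qed
  then show ?thesis unfolding contains_cycle_def by blast
qed

text \<open>With only one prime factor the exchange property holds for arbitrary \<open>v\<close>. A shift \<open>v\<close> that
  leads from \<open>x\<close> to a point outside \<open>A\<close> leaves only the alternative \<open>u\<close>.\<close>

lemma cycles_one_prime:
  assumes "p dvd n" "n > 0" "\<And>r. prime r \<Longrightarrow> r dvd n \<Longrightarrow> r = p"
    and "A \<subset> {0..<int n}" "vanishes_at_order A n" "x \<in> A"
  shows "contains_cycle n p A x"
proof -
  obtain y where y: "y \<notin> A" "y \<in> {0..<int n}" using assms(4) by blast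
  have "(x + i * int (n div p)) mod int n \<in> A \<or> (x + (y - x)) mod int n \<in> A" for i
  proof (rule exchange[OF assms(2) _ assms(5,6)])
    fix k assume "\<not> coprime k (int n)"
    then obtain r where "prime r" "r dvd n" "int r dvd k" using not_coprime_prime_factor assms(2) by blast
    then show "int n dvd k * (i * int (n div p)) \<or> int n dvd k * (y - x)"
      using assms(1,3) multiple_of_cycle_step by blast
  qed (use assms(4) in blast)
  moreover have "(x + (y - x)) mod int n \<notin> A" using y by simp
  ultimately show ?thesis unfolding contains_cycle_def by blast
qed

lemma vanishing_contains_cycle:
  assumes "\<And>r. prime r \<Longrightarrow> r dvd n \<Longrightarrow> r = p \<or> r = q" "n > 0"
    and "A \<subset> {0..<int n}" "vanishes_at_order A n" "x \<in> A"
  shows "\<exists>r\<in>{p, q}. r dvd n \<and> contains_cycle n r A x"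
proof (cases "p dvd n")
  case p: True
  show ?thesis
  proof (cases "q dvd n")
    case True
    then show ?thesis using cycles_two_primes[OF p True assms(2,1) _ assms(4,5)] assms(3) p by blast
  next
    case False
    then have "contains_cycle n p A x" using assms p by (intro cycles_one_prime) auto
    then show ?thesis using p by blast
  qed
next
  case p: False
  show ?thesis
  proof (cases "q dvd n")
    case True
    then have "contains_cycle n q A x" using assms p by (intro cycles_one_prime) auto
    then show ?thesis using True by blast
  next
    case False
    have "n = 1"
    proof (rule ccontr)
      assume "n \<noteq> 1"
      then obtain r where "prime r" "r dvd n" using prime_factor_nat by blast
      then show False using assms(1) False p by blast
    qed
    then have "{0..<int n} = {0}" by auto
    then have "A = {}" using assms(3) by (auto simp: psubset_eq subset_singleton_iff)
    then show ?thesis using assms(5) by simp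
  qed
qed

text \<open>The representative of the coset in the last block of length \<open>s\<close> is at least
  \<open>(r - 1) * s\<close>.\<close>

lemma cycle_length:
  assumes "n = r * s" "r > 0" "s > 0" "A \<subseteq> {0..<int L}" "contains_cycle n r A x"
  shows "(r - 1) * s < L"
proof -
  have s: "n div r = s" using assms(1,2) by simp
  \<comment> \<open>the number of steps that leads from the block of \<open>x\<close> to the last block\<close>
  define i where "i = int (r - 1) - x div int s"
  have "x + i * int s = x mod int s + int (r - 1) * int s"
    unfolding i_def by (simp add: algebra_simps minus_div_mult_eq_mod[symmetric])
  moreover have "x mod int s < int s" "0 \<le> x mod int s" using assms(3) by auto
  moreover have "int n = int (r - 1) * int s + int s" using assms(1,2)
    by (cases r) (auto simp: algebra_simps)
  ultimately have "(x + i * int s) mod int n = x mod int s + int (r - 1) * int s"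
    by (simp add: mod_pos_pos_trivial)
  then have "x mod int s + int (r - 1) * int s < int L"
    using assms(4,5) s unfolding contains_cycle_def by (metis atLeastLessThan_iff subsetD)
  then have "int ((r - 1) * s) < int L" using \<open>0 \<le> x mod int s\<close> by simp
  then show ?thesis by linarith
qed

lemma cycle_card:
  assumes "n = r * s" "r > 0" "s > 0" "finite A" "contains_cycle n r A x"
  shows "r \<le> card A"
proof -
  have s: "n div r = s" using assms(1,2) by simp
  define f where "f i = (x + int i * int s) mod int n" for i :: nat
  have "f ` {..<r} \<subseteq> A" using assms(5) s unfolding f_def contains_cycle_def by auto
  moreover have "inj_on f {..<r}"
  proof
    fix i j assume ij: "i \<in> {..<r}" "j \<in> {..<r}" "f i = f j"
    then have "int n dvd (x + int i * int s) - (x + int j * int s)"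
      unfolding f_def by (simp only: mod_eq_dvd_iff)
    then have "int r * int s dvd (int i - int j) * int s" using assms(1) by (simp add: algebra_simps)
    then have "int r dvd int i - int j" using assms(3) by simp
    then have "int i mod int r = int j mod int r" by (simp only: mod_eq_dvd_iff)
    then show "i = j" using ij by simp
  qed
  ultimately show ?thesis using assms(4) by (metis card_image card_lessThan card_mono)
qed

lemma vanishing_order_less:
  assumes "\<And>r. prime r \<Longrightarrow> r dvd n \<Longrightarrow> r = p \<or> r = q" "prime p" "prime q"
    and "A \<subseteq> {0..<int L}" "A \<noteq> {}" "vanishes_at_order A n" "L < n"
  shows "\<exists>r\<in>{p, q}. r dvd n \<and> (r - 1) * (n div r) < L" "n < 2 * L"
proof -
  obtain x where x: "x \<in> A" using assms(5) by blast
  have "n > 0" using assms(7) by simp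
  have "A \<subset> {0..<int n}"
  proof
    show "A \<subseteq> {0..<int n}" using assms(4,7) by fastforce
    have "int L \<in> {0..<int n}" "int L \<notin> A" using assms(4,7) by auto
    then show "A \<noteq> {0..<int n}" by blast
  qed
  from vanishing_contains_cycle[OF assms(1) \<open>n > 0\<close> this assms(6) x]
  obtain r where r: "r = p \<or> r = q" "r dvd n" "contains_cycle n r A x" by blast
  have rp: "prime r" using r(1) assms(2,3) by blast
  have n: "n = r * (n div r)" using r(2) by simp
  have s0: "n div r > 0" using r(2) \<open>n > 0\<close> prime_gt_0_nat[OF rp] by (simp add: div_greater_zero_iff dvd_imp_le)
  have b: "(r - 1) * (n div r) < L"
    by (rule cycle_length[OF n prime_gt_0_nat[OF rp] s0 assms(4) r(3)])
  then show "\<exists>r\<in>{p, q}. r dvd n \<and> (r - 1) * (n div r) < L" using r by blast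
  have "r \<le> 2 * (r - 1)" using prime_ge_2_nat[OF rp] by linarith
  then have "n \<le> 2 * ((r - 1) * (n div r))" using n by (metis mult.assoc mult_le_mono1)
  then show "n < 2 * L" using b by linarith
qed

section \<open>Unitary matrices and spectral pairs\<close>

text \<open>A square matrix with orthonormal columns has orthonormal rows. The matrix \<open>P = U U\<^sup>*\<close> is Hermitian
  and idempotent, so the squared norm of row \<open>a\<close> of \<open>P - 1\<close> is \<open>1 - P a a\<close>; these add up to
  \<open>card A\<close> minus the trace of \<open>P\<close>, which is the trace \<open>card B\<close> of \<open>U\<^sup>* U\<close>.\<close>

lemma unitary_onI_columns:
  fixes U :: "'a \<Rightarrow> 'b \<Rightarrow> complex"
  assumes fin: "finite A" "finite B" and card: "card A = card B"
    and col: "\<And>b b'. b \<in> B \<Longrightarrow> b' \<in> B \<Longrightarrow>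
      (\<Sum>a\<in>A. cnj (U a b) * U a b') = (if b = b' then 1 else 0)"
  shows "unitary_on A B U"
proof -
  define P where "P a a' = (\<Sum>b\<in>B. U a b * cnj (U a' b))" for a a'
  define \<delta> :: "'a \<Rightarrow> 'a \<Rightarrow> complex" where "\<delta> a a' = (if a = a' then 1 else 0)" for a a'
  have cnjP: "cnj (P a a') = P a' a" for a a' unfolding P_def by (simp add: mult.commute)
  have idem: "(\<Sum>a'\<in>A. P a a' * P a' a) = P a a" for a
  proof -
    have "(\<Sum>a'\<in>A. P a a' * P a' a) =
        (\<Sum>a'\<in>A. \<Sum>b\<in>B. \<Sum>b'\<in>B. U a b * cnj (U a b') * (cnj (U a' b) * U a' b'))"
      unfolding P_def sum_product by (intro sum.cong refl) (simp only: mult_ac)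
    also have "\<dots> = (\<Sum>b\<in>B. \<Sum>a'\<in>A. \<Sum>b'\<in>B. U a b * cnj (U a b') * (cnj (U a' b) * U a' b'))"
      by (rule sum.swap)
    also have "\<dots> = (\<Sum>b\<in>B. \<Sum>b'\<in>B. \<Sum>a'\<in>A. U a b * cnj (U a b') * (cnj (U a' b) * U a' b'))"
      by (intro sum.cong refl sum.swap)
    also have "\<dots> = (\<Sum>b\<in>B. \<Sum>b'\<in>B. U a b * cnj (U a b') * (if b = b' then 1 else 0))"
      by (intro sum.cong refl) (simp only: sum_distrib_left[symmetric] col)
    also have "\<dots> = P a a" unfolding P_def using fin by (simp add: if_distrib cong: if_cong)
    finally show ?thesis .
  qed
  \<comment> \<open>expand the square; idempotence evaluates the quadratic term\<close>
  have row: "(\<Sum>a'\<in>A. of_real ((cmod (P a a' - \<delta> a a'))\<^sup>2)) = 1 - P a a" if "a \<in> A" for a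
  proof -
    have "(\<Sum>a'\<in>A. of_real ((cmod (P a a' - \<delta> a a'))\<^sup>2)) =
        (\<Sum>a'\<in>A. P a a' * P a' a - P a a' * \<delta> a a' - P a' a * \<delta> a a' + \<delta> a a')"
      by (intro sum.cong refl, unfold complex_norm_square)
        (simp add: cnjP \<delta>_def algebra_simps)
    also have "\<dots> = P a a - P a a - P a a + 1"
      unfolding sum.distrib sum_subtractf idem \<delta>_def
      using that fin by (simp add: if_distrib cong: if_cong)
    finally show ?thesis by simp
  qed
  have "(\<Sum>a\<in>A. P a a) = (\<Sum>b\<in>B. \<Sum>a\<in>A. cnj (U a b) * U a b)"
    unfolding P_def by (subst sum.swap) (simp add: mult.commute)
  also have "\<dots> = of_nat (card A)" using card by (simp add: col)
  finally have "(\<Sum>a\<in>A. \<Sum>a'\<in>A. of_real ((cmod (P a a' - \<delta> a a'))\<^sup>2)) = (0 :: complex)"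
    by (simp add: row sum_subtractf del: of_real_power)
  then have "of_real (\<Sum>a\<in>A. \<Sum>a'\<in>A. (cmod (P a a' - \<delta> a a'))\<^sup>2) = (0 :: complex)"
    by (simp only: of_real_sum)
  then have "(\<Sum>a\<in>A. \<Sum>a'\<in>A. (cmod (P a a' - \<delta> a a'))\<^sup>2) = 0"
    by (simp only: of_real_eq_0_iff)
  then have "\<forall>a\<in>A. \<forall>a'\<in>A. P a a' = \<delta> a a'"
    using fin by (simp add: sum_nonneg_eq_0_iff sum_nonneg)
  then show ?thesis unfolding unitary_on_def P_def \<delta>_def using col by blast
qed

text \<open>The two transforms use opposite signs in the exponent, so up to the normalisation they are
  complex conjugates of each other.\<close>

lemma nu_hat_eq_0_iff:
  assumes "finite A" "A \<noteq> {}"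
  shows "nu_hat (real_of_int ` A) \<xi> = 0 \<longleftrightarrow> exp_sum A \<xi> = 0"
proof -
  have "(\<Sum>a\<in>real_of_int ` A. exp (- (2 * of_real pi * \<i> * of_real \<xi> * of_real a))) = cnj (exp_sum A \<xi>)"
    unfolding exp_sum_def cnj_sum
    by (subst sum.reindex) (auto simp: inj_on_def unity_def cis_conv_exp exp_cnj mult_ac intro!: sum.cong)
  moreover have "card (real_of_int ` A) \<noteq> 0" using assms by simp
  ultimately show ?thesis unfolding nu_hat_def by simp
qed

lemma spectral_pairI:
  assumes "N \<ge> 1" "finite A" "finite B" "card A = card B" "A \<noteq> {}"
    and orth: "\<And>b b'. b \<in> B \<Longrightarrow> b' \<in> B \<Longrightarrow> b \<noteq> b' \<Longrightarrow> exp_sum A (of_int (b - b') / real N) = 0"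
  shows "spectral_pair N A B"
proof -
  define U :: "int \<Rightarrow> int \<Rightarrow> complex" where
    "U a b = (1 / of_real (sqrt (real (card A)))) *
        exp (2 * of_real pi * \<i> * of_int a * of_int b / of_nat N)" for a b
  have cA: "card A > 0" using assms(2,5) by (simp add: card_gt_0_iff)
  have prod: "cnj (U a b) * U a b' = (1 / of_nat (card A)) * unity (of_int (b' - b) / real N * of_int a)" for a b b'
  proof -
    have U: "U a c = (1 / of_real (sqrt (real (card A)))) * unity (of_int c / real N * of_int a)" for c
      unfolding U_def unity_def cis_conv_exp by (simp add: mult_ac)
    have "cnj (unity (of_int b / real N * of_int a)) = unity (- (of_int b / real N * of_int a))"
      unfolding unity_def by (simp add: cis_cnj)
    moreover have "- (of_int b / real N * of_int a) + of_int b' / real N * of_int a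
        = of_int (b' - b) / real N * of_int a" by (simp add: algebra_simps diff_divide_distrib)
    moreover have "complex_of_real (sqrt (real (card A))) * complex_of_real (sqrt (real (card A))) = of_nat (card A)"
      by (simp flip: of_real_mult)
    ultimately show ?thesis unfolding U by (simp add: unity_add[symmetric])
  qed
  have "unitary_on A B U"
  proof (rule unitary_onI_columns[OF assms(2,3,4)])
    fix b b' assume b: "b \<in> B" "b' \<in> B"
    have "(\<Sum>a\<in>A. cnj (U a b) * U a b') = (1 / of_nat (card A)) * exp_sum A (of_int (b' - b) / real N)"
      unfolding exp_sum_def by (simp only: prod sum_distrib_left)
    also have "\<dots> = (if b = b' then 1 else 0)"
    proof (cases "b = b'")
      case True
      then show ?thesis using cA by (simp add: exp_sum_def unity_def)
    next
      case False
      then show ?thesis using orth[of b' b] b by simp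
    qed
    finally show "(\<Sum>a\<in>A. cnj (U a b) * U a b') = (if b = b' then 1 else 0)" .
  qed
  then show ?thesis unfolding spectral_pair_def U_def using assms by auto
qed

text \<open>With two elements on each side, orthogonality means that the phase difference is half a turn.\<close>

lemma spectral_pair_two:
  assumes "N \<ge> 1" "2 * ((a - a') * (b - b')) = int N"
  shows "spectral_pair N {a, a'} {b, b'}"
proof -
  have ne: "a \<noteq> a'" "b \<noteq> b'" using assms by auto
  have zero: "exp_sum {a, a'} (of_int d / real N) = 0" if "d = b - b' \<or> d = b' - b" for d
  proof -
    have half: "unity (1 / 2) = -1" "unity (- (1 / 2)) = -1" by (simp_all add: unity_def cis_conv_exp exp_minus)
    have N: "real N = 2 * ((of_int a - of_int a') * (of_int b - of_int b'))"
      using arg_cong[OF assms(2), of real_of_int] by simp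
    define t where "t = of_int d / real N"
    have "t * (of_int a - of_int a') = 1 / 2 \<or> t * (of_int a - of_int a') = - (1 / 2)"
      using that ne unfolding t_def N by (auto simp: field_simps)
    then have "unity (t * (of_int a - of_int a')) = -1" using half by metis
    moreover have "t * of_int a = t * (of_int a - of_int a') + t * of_int a'" by (simp add: algebra_simps)
    ultimately have "unity (t * of_int a) = - unity (t * of_int a')"
      by (metis unity_add mult_minus1)
    then show ?thesis unfolding t_def[symmetric] exp_sum_def using ne by simp
  qed
  show ?thesis
  proof (rule spectral_pairI)
    fix c c' assume "c \<in> {b, b'}" "c' \<in> {b, b'}" "c \<noteq> c'"
    then show "exp_sum {a, a'} (of_int (c - c') / real N) = 0" by (intro zero) auto
  qed (use assms(1) ne in auto)
qed

section \<open>Orders at which a set can vanish\<close>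

text \<open>The inequality \<open>n > p\<^sup>2 q\<close> excludes small exponents, \<open>n < 2 p\<^sup>2 q\<close> excludes exponents that are both
  large, and the sharper bound for the prime \<open>r\<close> decides between the remaining orders
  \<open>p\<^sup>3\<close>, \<open>p\<^sup>4\<close>, \<open>q\<^sup>2\<close> and \<open>p q\<^sup>2\<close>. For \<open>p q\<^sup>2\<close> it leaves the consecutive primes \<open>2\<close> and \<open>3\<close>.\<close>

lemma vanishing_order_cases:
  fixes p q n r \<alpha> \<beta> :: nat
  assumes "prime p" "prime q" "p \<noteq> q" "\<alpha> \<le> 4" "\<beta> \<le> 2" "n = p ^ \<alpha> * q ^ \<beta>"
    and "p\<^sup>2 * q < n" "r = p \<or> r = q" "r dvd n" "(r - 1) * (n div r) < p\<^sup>2 * q"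
    and "n < 2 * (p\<^sup>2 * q)"
  shows "(p = 2 \<and> q = 3 \<and> n = 18) \<or> (n = p ^ 4 \<and> p * (p - 1) < q \<and> q < p\<^sup>2)"
proof -
  have p2: "p \<ge> 2" and q2: "q \<ge> 2" using assms(1,2) prime_ge_2_nat by auto
  have pq: "\<not> p dvd q" "\<not> q dvd p" using primes_dvd_imp_eq[of p q] primes_dvd_imp_eq[of q p] assms(1-3) by auto
  consider "\<beta> = 0" | "\<beta> = 1" | "\<beta> = 2" using assms(5) by linarith
  then show ?thesis
  proof cases
    case 1
    then have n: "n = p ^ \<alpha>" using assms(6) by simp
    have "\<not> \<alpha> \<le> 2"
    proof
      assume "\<alpha> \<le> 2"
      then have "p ^ \<alpha> \<le> p\<^sup>2" using p2 by (intro power_increasing) auto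
      also have "\<dots> \<le> p\<^sup>2 * q" using q2 by simp
      finally show False using assms(7) n by simp
    qed
    then consider "\<alpha> = 3" | "\<alpha> = 4" using assms(4) by linarith
    moreover have "r = p"
    proof (rule ccontr)
      assume "r \<noteq> p"
      then have "q dvd p ^ \<alpha>" using assms(8,9) n by auto
      then show False using pq assms(2) prime_dvd_power by blast
    qed
    ultimately show ?thesis
    proof cases
      case 1
      have "n div p = p\<^sup>2" using n 1 p2 by (simp add: power3_eq_cube power2_eq_square)
      then have "p\<^sup>2 * (p - 1) < p\<^sup>2 * q" using assms(10) \<open>r = p\<close> by (simp add: mult.commute)
      moreover have "p\<^sup>2 * q < p\<^sup>2 * p" using assms(7) n 1 by (simp add: power3_eq_cube power2_eq_square)
      ultimately have "p - 1 < q" "q < p" by simp_all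
      then show ?thesis by linarith
    next
      case 2
      have e: "p ^ 4 = p\<^sup>2 * p\<^sup>2" "p ^ 4 = p * (p\<^sup>2 * p)" by (simp_all add: eval_nat_numeral)
      have "n = p * (p\<^sup>2 * p)" unfolding n 2 by (rule e(2))
      then have "n div p = p\<^sup>2 * p" using p2 by (metis nonzero_mult_div_cancel_left not_numeral_le_zero)
      then have "(p - 1) * (p\<^sup>2 * p) < p\<^sup>2 * q" using assms(10) \<open>r = p\<close> by metis
      moreover have "(p - 1) * (p\<^sup>2 * p) = p\<^sup>2 * (p * (p - 1))" by (simp only: mult_ac)
      ultimately have "p\<^sup>2 * (p * (p - 1)) < p\<^sup>2 * q" by (simp only:)
      moreover have "p\<^sup>2 * q < p\<^sup>2 * p\<^sup>2" using assms(7) unfolding n 2 e(1) .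
      ultimately have "p * (p - 1) < q" "q < p\<^sup>2" by (simp_all only: mult_less_cancel1)
      then show ?thesis using n 2 by simp
    qed
  next
    case 2
    then have "p\<^sup>2 * q < p ^ \<alpha> * q" using assms(6,7) by simp
    then have "p\<^sup>2 < p ^ \<alpha>" by simp
    then have "2 < \<alpha>" using p2 by (simp add: power_strict_increasing_iff)
    then have "p * p\<^sup>2 \<le> p ^ \<alpha>" using p2 power_increasing[of 3 \<alpha> p] by (simp add: eval_nat_numeral)
    then have "2 * p\<^sup>2 \<le> p ^ \<alpha>" using p2 by (meson le_trans mult_le_mono1)
    then have "2 * p\<^sup>2 * q \<le> n" using assms(6) 2 by simp
    then show ?thesis using assms(11) by simp
  next
    case 3
    have "\<not> 2 \<le> \<alpha>"
    proof
      assume "2 \<le> \<alpha>"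
      then have "p\<^sup>2 \<le> p ^ \<alpha>" using p2 by (intro power_increasing) auto
      then have "p\<^sup>2 * (q * q) \<le> n" using assms(6) 3 by (simp add: power2_eq_square[of q])
      moreover have "2 * (p\<^sup>2 * q) \<le> p\<^sup>2 * (q * q)" using q2 by (simp add: mult_ac)
      ultimately show False using assms(11) by linarith
    qed
    then consider "\<alpha> = 0" | "\<alpha> = 1" by linarith
    then show ?thesis
    proof cases
      case 1
      then have n: "n = q * q" using assms(6) 3 by (simp add: power2_eq_square)
      have "r = q"
      proof (rule ccontr)
        assume "r \<noteq> q"
        then have "p dvd q * q" using assms(8,9) n by auto
        then show False using pq assms(1) by (simp add: prime_dvd_mult_iff)
      qed
      then have "(q - 1) * q < p\<^sup>2 * q" using assms(10) n q2 by simp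
      then have "q - 1 < p\<^sup>2" by simp
      moreover have "p\<^sup>2 < q" using assms(7) n by simp
      ultimately show ?thesis by linarith
    next
      case 2
      then have n: "n = p * (q * q)" using assms(6) 3 by (simp add: power2_eq_square)
      have "(p * q) * p < (p * q) * q" using assms(7) n by (simp add: power2_eq_square mult_ac)
      then have less: "p < q" by simp
      have "r = p"
      proof (rule ccontr)
        assume "r \<noteq> p"
        then have "(p * q) * (q - 1) < (p * q) * p" using assms(8,10) n q2 by (simp add: power2_eq_square mult_ac)
        then have "q - 1 < p" by simp
        then show False using less by linarith
      qed
      then have "q * ((p - 1) * q) < q * p\<^sup>2" using assms(10) n p2 by (simp add: mult_ac)
      then have l: "(p - 1) * q < p\<^sup>2" by simp
      obtain k where k: "q = p + Suc k" using less by (metis less_iff_Suc_add add_Suc_right)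
      obtain m where m: "p = Suc (Suc m)" using p2 by (metis Suc_le_D numeral_2_eq_2 Suc_le_mono)
      have "k = 0"
      proof (rule ccontr)
        assume "k \<noteq> 0"
        then show False using l unfolding k m by (simp add: power2_eq_square algebra_simps)
      qed
      then have qp: "q = p + 1" using k by simp
      have "p = 2"
      proof (rule ccontr)
        assume "p \<noteq> 2"
        then have "odd p" "odd q" using prime_odd_nat[OF assms(1)] prime_odd_nat[OF assms(2)] p2 less by simp_all
        then show False using qp by simp
      qed
      then show ?thesis using qp n by simp
    qed
  qed
qed

text \<open>In lowest terms the frequency is \<open>m / n\<close> with \<open>g * n = M\<^sup>2\<close> and \<open>d = g * m\<close>. As \<open>g \<le> d < M\<close>, the order \<open>n\<close>
  exceeds \<open>M\<close>, so the classification of possible orders applies; the bound \<open>d < M\<close> then leaves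
  only \<open>m = 1\<close>.\<close>

lemma bad_difference_cases:
  fixes p q M :: nat and d :: int
  assumes "prime p" "prime q" "p \<noteq> q" "M = p\<^sup>2 * q"
    and "A \<subseteq> {0..<int M}" "A \<noteq> {}" "0 < d" "d < int M"
    and "exp_sum A (of_int d / (real M)\<^sup>2) = 0"
  shows "(p = 2 \<and> q = 3 \<and> d = 8 \<and> vanishes_at_order A 18) \<or>
    (d = (int q)\<^sup>2 \<and> p * (p - 1) < q \<and> q < p\<^sup>2 \<and> vanishes_at_order A (p ^ 4))"
proof -
  have pos: "p > 0" "q > 0" "M > 0" using assms(1,2,4) prime_gt_0_nat by auto
  define g where "g = nat (gcd d (int (M\<^sup>2)))"
  have gi: "int g = gcd d (int (M\<^sup>2))" unfolding g_def by simp
  have gp: "g > 0" using assms(7) unfolding g_def by simp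
  obtain n where n: "M\<^sup>2 = g * n" using gi by (metis dvdE gcd_dvd2 int_dvd_int_iff)
  obtain m where m: "d = int g * m" using gi by (metis dvd_def gcd_dvd1)
  have np: "n > 0" using n pos by (cases n) auto
  have "int g = int g * gcd m (int n)"
    using gi gcd_mult_left[of "int g" m "int n"] by (simp add: m n)
  then have cop: "coprime m (int n)" using gp by (simp add: coprime_iff_gcd_eq_1)
  have "int g \<le> d" using gi assms(7) by (metis gcd_dvd1 zdvd_imp_le)
  then have "g < M" using assms(8) by linarith
  have "real (M\<^sup>2) = real g * real n" using n by (metis of_nat_mult)
  then have t: "of_int d / (real M)\<^sup>2 * real n = of_int m" using gp np by (simp add: m)
  have fin: "finite A" "A \<subseteq> {0..}" using assms(5) finite_subset by auto
  have van: "vanishes_at_order A n"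
    by (rule exp_sum_lowest_terms[OF fin np cop assms(9) t])
  have "M < n"
  proof (rule ccontr)
    assume "\<not> M < n"
    then have "g * n < M * M" using \<open>g < M\<close> np by (intro mult_less_le_imp_less) auto
    then show False using n by (simp add: power2_eq_square)
  qed
  have M2: "M\<^sup>2 = p ^ 4 * q\<^sup>2" unfolding assms(4) by (simp add: power_mult_distrib)
  have "n dvd p ^ 4 * q\<^sup>2" using n M2 by (metis dvd_triv_right)
  then obtain x y where "n = x * y" "x dvd p ^ 4" "y dvd q\<^sup>2" using division_decomp by blast
  then obtain \<alpha> \<beta> where ab: "\<alpha> \<le> 4" "\<beta> \<le> 2" "n = p ^ \<alpha> * q ^ \<beta>"
    using assms(1,2) by (metis divides_primepow_nat)
  have pr: "s = p \<or> s = q" if "prime s" "s dvd n" for s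
    using that ab(3) assms(1,2) by (metis prime_dvd_mult_iff prime_dvd_power primes_dvd_imp_eq)
  obtain r where r: "r = p \<or> r = q" "r dvd n" "(r - 1) * (n div r) < M"
    using vanishing_order_less(1)[OF pr assms(1,2,5,6) van \<open>M < n\<close>] by blast
  have "n < 2 * M" using vanishing_order_less(2)[OF pr assms(1,2,5,6) van \<open>M < n\<close>] .
  from vanishing_order_cases[OF assms(1-3) ab _ r(1,2)] \<open>M < n\<close> this r(3) assms(4)
  have "(p = 2 \<and> q = 3 \<and> n = 18) \<or> (n = p ^ 4 \<and> p * (p - 1) < q \<and> q < p\<^sup>2)" by simp
  then show ?thesis
  proof
    assume h: "p = 2 \<and> q = 3 \<and> n = 18"
    then have "g = 8" "M = 12" using n assms(4) by auto
    then have "d = 8" using m assms(7,8) by auto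
    then show ?thesis using h van by auto
  next
    assume h: "n = p ^ 4 \<and> p * (p - 1) < q \<and> q < p\<^sup>2"
    then have g: "g = q\<^sup>2" using n M2 pos by (simp add: mult.commute)
    have "m < 2"
    proof (rule ccontr)
      assume "\<not> m < 2"
      then have "int q * (int q * 2) \<le> int q * (int q * m)" by (intro mult_left_mono) auto
      also have "\<dots> < int q * (int p)\<^sup>2" using assms(8) unfolding m g assms(4)
        by (simp add: power2_eq_square mult_ac)
      finally have "int q * 2 < (int p)\<^sup>2" using pos by simp
      then have "2 * q < p\<^sup>2" by (metis mult.commute of_nat_less_iff of_nat_mult of_nat_numeral of_nat_power)
      moreover obtain k where "p = Suc (Suc k)" using prime_ge_2_nat[OF assms(1)]
        by (metis Suc_le_D numeral_2_eq_2 Suc_le_mono)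
      ultimately show False using h by (simp add: power2_eq_square algebra_simps)
    qed
    then have "m = 1" using m assms(7) gp by (smt (verit) mult_nonneg_nonpos of_nat_0_le_iff)
    then show ?thesis using h m g van by auto
  qed
qed

section \<open>The two exceptional configurations\<close>

text \<open>Since \<open>(q\<^sup>2 + M * e) / M\<^sup>2 = (q + p\<^sup>2 * e) / (p\<^sup>4 * q)\<close>, a difference \<open>e\<close> not divisible by \<open>q\<close> would make \<open>A\<close>
  vanish at order \<open>p\<^sup>4 q\<close>, which is too large. So all differences are multiples \<open>q * k\<close>. If \<open>p\<close> does not
  divide \<open>k\<close>, the first alternative would mean vanishing at order \<open>p\<^sup>2\<close>, which fails, and the second
  is possible only if \<open>q\<close> divides \<open>k\<close>; by size the difference is then \<open>q\<^sup>2\<close> or \<open>- q\<^sup>2\<close>. A third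
  element of \<open>B\<close> would differ from one of the two given ones by an amount prime to \<open>p\<close>, and it
  would then lie at distance \<open>2 q\<^sup>2 > M\<close> from the other. Finally \<open>A\<close>, with two elements, contains
  a coset of \<open>p\<close> elements.\<close>

lemma square_difference_case:
  fixes p q M :: nat and b0 :: int
  assumes pr: "prime p" "prime q" "p \<noteq> q" and M: "M = p\<^sup>2 * q"
    and A: "A \<subseteq> {0..<int M}" "A \<noteq> {}" and B: "B \<subseteq> {0..<int M}" and card: "card A = card B"
    and dist: "\<And>b b'. b \<in> B \<Longrightarrow> b' \<in> B \<Longrightarrow> b \<noteq> b' \<Longrightarrow>
      exp_sum A (of_int (b - b') / real M) = 0 \<or>
      (\<forall>c\<in>B. \<forall>c'\<in>B. exp_sum A (of_int (b - b') / (real M)\<^sup>2 + of_int (c - c') / real M) = 0)"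
    and b: "b0 \<in> B" "b0 + (int q)\<^sup>2 \<in> B"
    and bad: "exp_sum A (of_int ((int q)\<^sup>2) / real M) \<noteq> 0"
    and van: "vanishes_at_order A (p ^ 4)" and small: "p * (p - 1) < q" "q < p\<^sup>2"
  shows "p = 2 \<and> q = 3 \<and> (\<exists>x. A = {x, x + 8}) \<and> B = {b0, b0 + 9}"
proof -
  have pos: "p > 0" "q > 0" "M > 0" using pr M prime_gt_0_nat by auto
  have p2: "p \<ge> 2" using pr(1) prime_ge_2_nat by auto
  have fin: "finite A" "A \<subseteq> {0..}" using A finite_subset by auto
  have ip: "prime (int p)" "prime (int q)" using pr by auto
  have cpq: "coprime (int p) (int q)" using pr by (simp add: primes_coprime)
  have np_q: "\<not> int p dvd int q" and nq_p: "\<not> int q dvd int p"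
    using pr primes_dvd_imp_eq[of p q] primes_dvd_imp_eq[of q p] by auto
  have rpos: "real p > 0" "real q > 0" using pos by auto
  have rM: "real M = (real p)\<^sup>2 * real q" by (simp add: M)
  have prime_divs: "s = p \<or> s = q" if "prime s" "s dvd p ^ 4 * q" for s
    using that pr(1,2) by (metis prime_dvd_mult_iff prime_dvd_power primes_dvd_imp_eq)
  have large: "2 * M \<le> p ^ 4 * q"
  proof -
    have "2 \<le> p * p" using p2 by (metis le_trans mult_le_mono2 mult_1_right nat_le_linear one_le_numeral)
    then have "2 * (p * p * q) \<le> (p * p) * (p * p * q)" by (rule mult_le_mono1)
    then show ?thesis by (simp add: M eval_nat_numeral mult_ac)
  qed
  have no_large: "\<not> vanishes_at_order A (p ^ 4 * q)"
  proof
    assume v: "vanishes_at_order A (p ^ 4 * q)"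
    have "M < p ^ 4 * q" using large pos by linarith
    from vanishing_order_less(2)[OF prime_divs pr(1,2) A v this] show False using large by simp
  qed
  have no_p2: "\<not> vanishes_at_order A (p\<^sup>2)"
  proof
    assume "vanishes_at_order A (p\<^sup>2)"
    then have "exp_sum A (of_int ((int q)\<^sup>2) / real M) = 0"
    proof (rule vanishes_at_orderD[where m = "int q"])
      show "coprime (int q) (int (p\<^sup>2))" using cpq by (simp add: coprime_commute)
      show "of_int ((int q)\<^sup>2) / real M * real (p\<^sup>2) = of_int (int q)"
        using rpos by (simp add: rM power2_eq_square)
    qed (use pos in simp)
    then show False using bad by simp
  qed
  have second: "\<forall>c\<in>B. \<forall>c'\<in>B. exp_sum A (of_int ((int q)\<^sup>2) / (real M)\<^sup>2 + of_int (c - c') / real M) = 0"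
    using dist[OF b(2,1)] bad pos by simp
  have q_dvd: "int q dvd c - c'" if c: "c \<in> B" "c' \<in> B" for c c'
  proof (rule ccontr)
    assume nd: "\<not> int q dvd c - c'"
    define e where "e = c - c'"
    have "vanishes_at_order A (p ^ 4 * q)"
    proof (rule exp_sum_lowest_terms[OF fin])
      show "exp_sum A (of_int ((int q)\<^sup>2) / (real M)\<^sup>2 + of_int e / real M) = 0"
        using second c unfolding e_def by blast
      have "\<not> int p dvd int q + (int p)\<^sup>2 * e"
        using np_q by (simp add: dvd_add_left_iff power2_eq_square)
      then have "coprime (int p) (int q + (int p)\<^sup>2 * e)" using ip(1) by (simp add: prime_imp_coprime)
      moreover have "coprime (int q) (int q + (int p)\<^sup>2 * e)"
      proof -
        have "\<not> int q dvd (int p)\<^sup>2 * e"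
          using nd nq_p ip(2) unfolding e_def by (simp add: prime_dvd_mult_iff power2_eq_square)
        then show ?thesis using ip(2) by (simp add: prime_imp_coprime)
      qed
      ultimately show "coprime (int q + (int p)\<^sup>2 * e) (int (p ^ 4 * q))"
        by (simp add: coprime_commute)
      show "(of_int ((int q)\<^sup>2) / (real M)\<^sup>2 + of_int e / real M) * real (p ^ 4 * q)
        = of_int (int q + (int p)\<^sup>2 * e)"
        using rpos by (simp add: rM field_simps eval_nat_numeral)
    qed (use pos in simp)
    then show False using no_large by simp
  qed
  have q_large: "p\<^sup>2 < 2 * q"
  proof -
    obtain k where "p = Suc (Suc k)" using p2 by (metis Suc_le_D numeral_2_eq_2 Suc_le_mono)
    then show ?thesis using small(1) by (simp add: power2_eq_square algebra_simps)
  qed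
  have step: "c - c' = (int q)\<^sup>2 \<or> c - c' = - (int q)\<^sup>2"
    if c: "c \<in> B" "c' \<in> B" and np: "\<not> int p dvd c - c'" for c c'
  proof -
    obtain k where k: "c - c' = int q * k" using q_dvd[OF c] by blast
    have "\<not> int p dvd k" using np k by auto
    then have pk: "coprime k (int p)" using ip(1) by (metis coprime_commute prime_imp_coprime)
    have ne: "c \<noteq> c'" using np by auto
    have "exp_sum A (of_int (c - c') / real M) \<noteq> 0"
    proof
      assume z: "exp_sum A (of_int (c - c') / real M) = 0"
      have "vanishes_at_order A (p\<^sup>2)"
      proof (rule exp_sum_lowest_terms[OF fin _ _ z])
        show "coprime k (int (p\<^sup>2))" using pk by simp
        show "of_int (c - c') / real M * real (p\<^sup>2) = of_int k"
          unfolding k using rpos by (simp add: rM power2_eq_square)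
      qed (use pos in simp)
      then show False using no_p2 by simp
    qed
    then have z: "exp_sum A (of_int (c - c') / (real M)\<^sup>2) = 0"
      using dist[OF c ne] b(1) by fastforce
    have "int q dvd k"
    proof (rule ccontr)
      assume "\<not> int q dvd k"
      then have qk: "coprime k (int q)" using ip(2) by (metis coprime_commute prime_imp_coprime)
      have "vanishes_at_order A (p ^ 4 * q)"
      proof (rule exp_sum_lowest_terms[OF fin _ _ z])
        show "coprime k (int (p ^ 4 * q))" using pk qk by simp
        show "of_int (c - c') / (real M)\<^sup>2 * real (p ^ 4 * q) = of_int k"
          unfolding k using rpos by (simp add: rM field_simps eval_nat_numeral)
      qed (use pos in simp)
      then show False using no_large by simp
    qed
    then obtain l where l: "k = int q * l" by blast
    have "c \<in> {0..<int M}" "c' \<in> {0..<int M}" using B c by auto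
    then have "\<bar>c - c'\<bar> < int M" by auto
    then have "int q * (int q * \<bar>l\<bar>) < int q * (int p)\<^sup>2"
      unfolding k l M by (simp add: abs_mult mult_ac)
    then have "int q * \<bar>l\<bar> < (int p)\<^sup>2" using pos by simp
    moreover have "(int p)\<^sup>2 < int q * 2" using q_large
      by (metis mult.commute of_nat_less_iff of_nat_mult of_nat_numeral of_nat_power)
    ultimately have "int q * \<bar>l\<bar> < int q * 2" by linarith
    then have "\<bar>l\<bar> < 2" using pos by simp
    moreover have "l \<noteq> 0" using ne k l by auto
    ultimately have "l = 1 \<or> l = -1" by linarith
    then show ?thesis using k l by (auto simp: power2_eq_square)
  qed
  have far: "int M < 2 * (int q)\<^sup>2"
  proof -
    have "p\<^sup>2 * q < 2 * q * q" using q_large pos by simp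
    then have "int (p\<^sup>2 * q) < int (2 * q * q)" by (simp only: of_nat_less_iff)
    then show ?thesis unfolding M by (simp add: power2_eq_square)
  qed
  have False if c: "c \<in> B" "c \<noteq> b0" "c \<noteq> b0 + (int q)\<^sup>2" for c
  proof -
    have "\<not> int p dvd (int q)\<^sup>2"
      using np_q ip(1) prime_dvd_power by blast
    moreover have "(c - b0) - (c - (b0 + (int q)\<^sup>2)) = (int q)\<^sup>2" by simp
    ultimately have "\<not> int p dvd c - b0 \<or> \<not> int p dvd c - (b0 + (int q)\<^sup>2)"
      by (metis dvd_diff)
    moreover have "c \<in> {0..<int M}" "b0 \<in> {0..<int M}" "b0 + (int q)\<^sup>2 \<in> {0..<int M}"
      using B b c by auto
    ultimately show False
      using step[OF c(1) b(1)] step[OF c(1) b(2)] c(2,3) far by auto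
  qed
  then have BB: "B = {b0, b0 + (int q)\<^sup>2}" using b by blast
  have cA: "card A = 2" using BB card pos by simp
  obtain x where x: "x \<in> A" using A(2) by blast
  have n4: "p ^ 4 = p * p ^ 3" by (simp add: eval_nat_numeral)
  have Ml: "M < p ^ 4" unfolding M using small(2) pos by (simp add: eval_nat_numeral)
  have sub: "A \<subset> {0..<int (p ^ 4)}"
  proof
    have "{0..<int M} \<subseteq> {0..<int (p ^ 4)}" using Ml by auto
    then show "A \<subseteq> {0..<int (p ^ 4)}" using A(1) by blast
    have "int M \<in> {0..<int (p ^ 4)}" "int M \<notin> A" using A(1) Ml by auto
    then show "A \<noteq> {0..<int (p ^ 4)}" by blast
  qed
  have cyc: "contains_cycle (p ^ 4) p A x"
  proof (rule cycles_one_prime[OF _ _ _ sub van x])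
    fix r assume "prime r" "r dvd p ^ 4"
    then show "r = p" using pr(1) by (metis prime_dvd_power primes_dvd_imp_eq)
  qed (use pos in auto)
  have "p \<le> card A" using pos by (intro cycle_card[OF n4 _ _ fin(1) cyc]) auto
  then have p: "p = 2" using cA p2 by simp
  have "odd q" using pr p prime_ge_2_nat[of q] by (metis le_neq_implies_less prime_odd_nat)
  then have q: "q = 3" using small p by (auto simp: numeral_eq_Suc less_Suc_eq)
  have "(x + 1 * int (2 ^ 4 div 2)) mod int (2 ^ 4) \<in> A"
    using cyc unfolding contains_cycle_def p by blast
  then have y: "(x + 8) mod 16 \<in> A" by simp
  have x12: "0 \<le> x" "x < 12" using x A(1) M p q by auto
  have "\<exists>x. A = {x, x + 8}"
  proof (cases "x < 8")
    case True
    then have "x + 8 \<in> A" using y x12 by simp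
    then have "{x, x + 8} = A" using x cA fin(1) by (intro card_subset_eq) auto
    then show ?thesis by blast
  next
    case False
    have "(x + 8) mod 16 = x - 8" using x12 False by presburger
    then have "x - 8 \<in> A" using y by simp
    then have "{x - 8, x - 8 + 8} = A" using x cA fin(1) by (intro card_subset_eq) auto
    then show ?thesis by metis
  qed
  then show ?thesis using p q BB by simp
qed

text \<open>Vanishing at order \<open>18\<close> makes \<open>A\<close> closed under the shift by \<open>9\<close> modulo \<open>18\<close>, so \<open>A\<close> consists of
  pairs \<open>{x, x + 9}\<close> with \<open>x\<close> in \<open>{0, 1, 2}\<close>. The frequencies \<open>(2 + 3 * e) / 36\<close> have order \<open>36\<close> for odd
  \<open>e\<close> and order \<open>9\<close> for \<open>e\<close> congruent to \<open>2\<close> modulo \<open>4\<close>; both are impossible, so all differences of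
  \<open>B\<close> are multiples of \<open>4\<close>. The difference \<open>4\<close> itself would need vanishing at order \<open>3\<close> or \<open>36\<close>.\<close>

lemma modulus_twelve_case:
  fixes b0 :: int
  assumes A: "A \<subseteq> {0..<12}" "A \<noteq> {}" and B: "B \<subseteq> {0..<12}" and card: "card A = card B"
    and dist: "\<And>b b'. b \<in> B \<Longrightarrow> b' \<in> B \<Longrightarrow> b \<noteq> b' \<Longrightarrow>
      exp_sum A (of_int (b - b') / 12) = 0 \<or>
      (\<forall>c\<in>B. \<forall>c'\<in>B. exp_sum A (of_int (b - b') / 144 + of_int (c - c') / 12) = 0)"
    and b: "b0 \<in> B" "b0 + 8 \<in> B"
    and bad: "exp_sum A (8 / 12) \<noteq> 0" and van: "vanishes_at_order A 18"
  shows "(\<exists>x. A = {x, x + 9}) \<and> B = {b0, b0 + 8}"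
proof -
  have fin: "finite A" "A \<subseteq> {0..}" using A finite_subset by auto
  have A12: "A \<subseteq> {0..<int 12}" using A by simp
  have two_three: "prime (2::nat)" "prime (3::nat)" by auto
  have divs: "s = 2 \<or> s = 3" if "prime s" "s dvd n" "n \<in> {9, 18, 36}" for s n :: nat
  proof -
    have "n dvd 2 ^ 2 * 3 ^ 2" using that(3) by auto
    then have "s dvd 2 ^ 2 * 3 ^ 2" using that(2) dvd_trans by blast
    then show ?thesis using that(1) two_three
      by (metis prime_dvd_mult_iff prime_dvd_power primes_dvd_imp_eq)
  qed
  have no36: "\<not> vanishes_at_order A 36"
  proof
    assume "vanishes_at_order A 36"
    from vanishing_order_less(2)[OF divs[of _ 36] two_three A12 A(2) this] show False by simp
  qed
  have no3: "\<not> vanishes_at_order A 3"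
  proof
    assume "vanishes_at_order A 3"
    then have "exp_sum A (8 / 12) = 0"
      by (rule vanishes_at_orderD[where m = 2]) auto
    then show False using bad by simp
  qed
  have shift: "(x + 9) mod 18 \<in> A" if x: "x \<in> A" for x
  proof -
    have sub: "A \<subset> {0..<int 18}"
    proof
      show "A \<subseteq> {0..<int 18}" using A by fastforce
      have "12 \<in> {0..<int 18}" "12 \<notin> A" using A(1) by auto
      then show "A \<noteq> {0..<int 18}" by blast
    qed
    obtain r where r: "r = 2 \<or> r = 3" "contains_cycle 18 r A x"
      using vanishing_contains_cycle[OF divs[of _ 18] _ sub van x] by auto
    have "r \<noteq> 3"
    proof
      assume "r = 3"
      then have "contains_cycle 18 3 A x" using r by simp
      from cycle_length[OF _ _ _ A12 this, of 6] show False by simp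
    qed
    then have "contains_cycle 18 2 A x" using r by auto
    then have "(x + 1 * int (18 div 2)) mod int 18 \<in> A" unfolding contains_cycle_def by blast
    then show ?thesis by simp
  qed
  have dichotomy: "a < 3 \<or> a \<ge> 9" if a: "a \<in> A" for a
  proof (rule ccontr)
    assume n: "\<not> ?thesis"
    then have "(a + 9) mod 18 = a + 9" by simp
    then have "a + 9 \<in> A" using shift[OF a] by simp
    then show False using A(1) n by auto
  qed
  have no9: "\<not> vanishes_at_order A 9"
  proof
    assume v: "vanishes_at_order A 9"
    \<comment> \<open>modulo \<open>9\<close> the set \<open>A\<close> is the lower half \<open>X\<close> counted twice, and \<open>X\<close> lies in an interval too short
      for a cycle of order \<open>9\<close>\<close>
    define X where "X = {a \<in> A. a < 9}"
    have X3: "X \<subseteq> {0..<int 3}" using dichotomy A(1) unfolding X_def by force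
    have split: "A = X \<union> (\<lambda>a. a + 9) ` X"
    proof
      show "A \<subseteq> X \<union> (\<lambda>a. a + 9) ` X"
      proof
        fix a assume a: "a \<in> A"
        show "a \<in> X \<union> (\<lambda>a. a + 9) ` X"
        proof (cases "a < 9")
          case False
          have "a < 12" using a A(1) by auto
          then have "(a + 9) mod 18 = a - 9" using False by presburger
          then have "a - 9 \<in> X" using shift[OF a] a A(1) unfolding X_def by auto
          then show ?thesis by (auto intro!: rev_image_eqI)
        qed (use a X_def in auto)
      qed
      have "a + 9 \<in> A" if "a \<in> X" for a
      proof -
        have "(a + 9) mod 18 = a + 9" using that X3 by auto
        then show ?thesis using shift[of a] that unfolding X_def by auto
      qed
      then show "X \<union> (\<lambda>a. a + 9) ` X \<subseteq> A" unfolding X_def by auto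
    qed
    have finX: "finite X" using fin unfolding X_def by simp
    have disj: "X \<inter> (\<lambda>a. a + 9) ` X = {}" by (auto dest!: subsetD[OF X3])
    have double: "exp_sum A (of_int j / real 9) = 2 * exp_sum X (of_int j / real 9)" for j
    proof -
      have "of_int j / real 9 * of_int (a + 9) = of_int j / real 9 * of_int a + of_int j" for a
        by (simp add: field_simps)
      then have "unity (of_int j / real 9 * of_int (a + 9)) = unity (of_int j / real 9 * of_int a)" for a
        by (simp only: unity_add_of_int)
      then have "exp_sum ((\<lambda>a. a + 9) ` X) (of_int j / real 9) = exp_sum X (of_int j / real 9)"
        unfolding exp_sum_def by (subst sum.reindex) (auto simp del: of_int_add)
      moreover have "exp_sum A (of_int j / real 9) =
          exp_sum X (of_int j / real 9) + exp_sum ((\<lambda>a. a + 9) ` X) (of_int j / real 9)"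
        using finX disj unfolding exp_sum_def by (subst split) (auto intro!: sum.union_disjoint)
      ultimately show ?thesis by simp
    qed
    have vX: "vanishes_at_order X 9"
      using v unfolding vanishes_at_order_def double by auto
    have "X \<noteq> {}" using split A(2) by auto
    from vanishing_order_less(2)[OF divs[of _ 9] two_three X3 this vX] show False by simp
  qed
  have coprime_3: "coprime (2 + 3 * i) (3 :: int)" for i
  proof -
    have "\<not> 3 dvd 2 + 3 * i" by presburger
    then have "coprime 3 (2 + 3 * i)" by (intro prime_imp_coprime) simp_all
    then show ?thesis by (simp only: coprime_commute)
  qed
  have second: "exp_sum A (8 / 144 + of_int (c - c') / 12) = 0" if "c \<in> B" "c' \<in> B" for c c'
    using dist[OF b(2,1)] bad that by auto
  have four_dvd: "4 dvd c - c'" if c: "c \<in> B" "c' \<in> B" for c c'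
  proof (rule ccontr)
    assume n4: "\<not> 4 dvd c - c'"
    define e where "e = c - c'"
    have z: "exp_sum A (8 / 144 + of_int e / 12) = 0" using second[OF c] unfolding e_def .
    show False
    proof (cases "even e")
      case False
      have "coprime (2 + 3 * e) 2" using False by simp
      moreover have "coprime (2 + 3 * e) 3" by (rule coprime_3)
      ultimately have "coprime (2 + 3 * e) (2\<^sup>2 * 3\<^sup>2)"
        by (simp only: coprime_mult_right_iff coprime_power_right_iff simp_thms)
      then have "coprime (2 + 3 * e) (int 36)" by simp
      then have "vanishes_at_order A 36"
        by (intro exp_sum_lowest_terms[OF fin _ _ z, where m = "2 + 3 * e"]) simp_all
      then show False using no36 by simp
    next
      case True
      then obtain f where f: "e = 2 * f" by blast
      have "odd f" using n4 f unfolding e_def by auto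
      then obtain g where g: "f = 2 * g + 1" by (elim oddE)
      have "coprime (2 + 3 * g) 3" by (rule coprime_3)
      then have "coprime (2 + 3 * g) (3\<^sup>2)" by (simp only: coprime_power_right_iff simp_thms)
      then have "coprime (2 + 3 * g) (int 9)" by simp
      then have "vanishes_at_order A 9"
        using f g by (intro exp_sum_lowest_terms[OF fin _ _ z, where m = "2 + 3 * g"]) (simp_all add: add_divide_distrib)
      then show False using no9 by simp
    qed
  qed
  have not4: "c - c' \<noteq> 4" if c: "c \<in> B" "c' \<in> B" for c c'
  proof
    assume d: "c - c' = 4"
    have "exp_sum A (of_int (c - c') / 12) \<noteq> 0"
    proof
      assume "exp_sum A (of_int (c - c') / 12) = 0"
      then have "vanishes_at_order A 3"
        using d by (intro exp_sum_lowest_terms[OF fin, where m = 1]) auto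
      then show False using no3 by simp
    qed
    moreover have "c \<noteq> c'" using d by auto
    ultimately have "exp_sum A (of_int (c - c') / 144 + of_int (c - c) / 12) = 0"
      using dist[OF c] c(1) by blast
    then have "vanishes_at_order A 36"
      using d by (intro exp_sum_lowest_terms[OF fin, where m = 1]) auto
    then show False using no36 by simp
  qed
  have False if c: "c \<in> B" "c \<noteq> b0" "c \<noteq> b0 + 8" for c
  proof -
    obtain k where k: "c - b0 = 4 * k" using four_dvd[OF c(1) b(1)] by blast
    have r: "0 \<le> c" "c < 12" "0 \<le> b0" "b0 + 8 < 12" using c b B by auto
    have "k \<noteq> 1" "k \<noteq> -1" "k \<noteq> 0" "k \<noteq> 2" using not4[OF c(1) b(1)] not4[OF b(1) c(1)] k c by auto
    then show False using r k by presburger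
  qed
  then have BB: "B = {b0, b0 + 8}" using b by blast
  have cA: "card A = 2" using BB card by simp
  obtain x where x: "x \<in> A" using A(2) by blast
  have x12: "0 \<le> x" "x < 12" using x A(1) by auto
  have "\<exists>x. A = {x, x + 9}"
  proof (cases "x < 9")
    case True
    then have "x + 9 \<in> A" using shift[OF x] x12 by simp
    then have "{x, x + 9} = A" using x cA fin(1) by (intro card_subset_eq) auto
    then show ?thesis by blast
  next
    case False
    have "(x + 9) mod 18 = x - 9" using x12 False by presburger
    then have "x - 9 \<in> A" using shift[OF x] by simp
    then have "{x - 9, x - 9 + 9} = A" using x cA fin(1) by (intro card_subset_eq) auto
    then show ?thesis by metis
  qed
  then show ?thesis using BB by simp
qed

section \<open>Distributed spectral pairs modulo \<open>p\<^sup>2 q\<close>\<close>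

lemma translate_of_pair: "translate_of {x, x + c} {0, c}"
  unfolding translate_of_def by (intro exI[of _ x]) (simp add: add.commute)

lemma exp_sum_uminus: "exp_sum A (- t) = cnj (exp_sum A t)"
  unfolding exp_sum_def by (simp add: unity_def cis_cnj)

theorem theorem4p5:
  fixes p q M :: nat and A B :: "int set"
  assumes "prime p" and "prime q" and "p \<noteq> q" and "M = p\<^sup>2 * q"
    and "A \<subseteq> {0..int M - 1}" and "B \<subseteq> {0..int M - 1}"
    and "1 < card A" and "card A = card B" and "card B < M"
    and "distributed_spectral_pair M A B"
  shows "spectral_pair M A B \<or>
    (p = 2 \<and> q = 3 \<and> spectral_pair (M\<^sup>2) A B \<and>
      ((translate_of A {0, 8} \<and> translate_of B {0, 9}) \<or>
       (translate_of A {0, 9} \<and> translate_of B {0, 8})))"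
proof (rule disj_imp[THEN iffD2], rule impI)
  assume not_spectral: "\<not> spectral_pair M A B"
  have pos: "M > 0" using assms(1,2,4) prime_gt_0_nat by simp
  have A: "A \<subseteq> {0..<int M}" "A \<noteq> {}" and B: "B \<subseteq> {0..<int M}" using assms(5-7) by auto
  have fin: "finite A" "finite B" using A B finite_subset by auto
  have dist: "exp_sum A (of_int (b - b') / real M) = 0 \<or>
      (\<forall>c\<in>B. \<forall>c'\<in>B. exp_sum A (of_int (b - b') / (real M)\<^sup>2 + of_int (c - c') / real M) = 0)"
    if "b \<in> B" "b' \<in> B" "b \<noteq> b'" for b b'
    using assms(10) that unfolding distributed_spectral_pair_def nu_hat_eq_0_iff[OF fin(1) A(2)] by blast
  obtain b b' where b: "b \<in> B" "b' \<in> B" "b \<noteq> b'" "exp_sum A (of_int (b - b') / real M) \<noteq> 0"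
    using not_spectral spectral_pairI[of M A B] pos fin assms(8) A(2) by auto
  \<comment> \<open>negating the frequency conjugates the sum, so the failing difference may be taken positive\<close>
  obtain b0 b1 where b01: "b0 \<in> B" "b1 \<in> B" "b0 < b1" "exp_sum A (of_int (b1 - b0) / real M) \<noteq> 0"
  proof (cases "b' < b")
    case True
    then show ?thesis using b that by blast
  next
    case False
    have "of_int (b' - b) / real M = - (of_int (b - b') / real M)"
      by (simp add: minus_divide_left)
    then have "exp_sum A (of_int (b' - b) / real M) \<noteq> 0"
      using b(4) by (simp only: exp_sum_uminus complex_cnj_zero_iff not_False_eq_True)
    then show ?thesis using b False that[of b b'] by auto
  qed
  define d where "d = b1 - b0"
  have b1: "b1 = b0 + d" unfolding d_def by simp
  have "b0 \<in> {0..<int M}" "b1 \<in> {0..<int M}" using b01 B by auto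
  then have d: "0 < d" "d < int M" using b01(3) unfolding d_def by auto
  have "exp_sum A (of_int d / (real M)\<^sup>2 + of_int (b0 - b0) / real M) = 0"
    using dist[OF b01(2,1)] b01 unfolding d_def by blast
  then have zero: "exp_sum A (of_int d / (real M)\<^sup>2) = 0" by simp
  have bad: "exp_sum A (of_int d / real M) \<noteq> 0" using b01(4) unfolding d_def .
  have b0d: "b0 + d \<in> B" using b01(2) unfolding d_def by simp
  from bad_difference_cases[OF assms(1-4) A d zero]
  show "p = 2 \<and> q = 3 \<and> spectral_pair (M\<^sup>2) A B \<and>
      ((translate_of A {0, 8} \<and> translate_of B {0, 9}) \<or>
       (translate_of A {0, 9} \<and> translate_of B {0, 8}))"
  proof
    assume h: "p = 2 \<and> q = 3 \<and> d = 8 \<and> vanishes_at_order A 18"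
    then have M: "M = 12" using assms(4) by simp
    have "(\<exists>x. A = {x, x + 9}) \<and> B = {b0, b0 + 8}"
    proof (rule modulus_twelve_case)
      show "A \<subseteq> {0..<12}" "A \<noteq> {}" "B \<subseteq> {0..<12}" using A B M by auto
      show "b0 + 8 \<in> B" "exp_sum A (8 / 12) \<noteq> 0" using b0d bad h M by auto
      show "exp_sum A (of_int (b - b') / 12) = 0 \<or>
        (\<forall>c\<in>B. \<forall>c'\<in>B. exp_sum A (of_int (b - b') / 144 + of_int (c - c') / 12) = 0)"
        if "b \<in> B" "b' \<in> B" "b \<noteq> b'" for b b'
        using dist[OF that] unfolding M by simp
    qed (use h b01 assms(8) in auto)
    then obtain x where AB: "A = {x, x + 9}" "B = {b0, b0 + 8}" by blast
    have "spectral_pair (M\<^sup>2) {x, x + 9} {b0, b0 + 8}"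
      unfolding M by (rule spectral_pair_two) auto
    moreover have "translate_of A {0, 9}" "translate_of B {0, 8}"
      unfolding AB by (rule translate_of_pair)+
    ultimately show ?thesis using AB h by simp
  next
    assume h: "d = (int q)\<^sup>2 \<and> p * (p - 1) < q \<and> q < p\<^sup>2 \<and> vanishes_at_order A (p ^ 4)"
    have "p = 2 \<and> q = 3 \<and> (\<exists>x. A = {x, x + 8}) \<and> B = {b0, b0 + 9}"
      using h bad b0d by (intro square_difference_case[OF assms(1-4) A B assms(8) dist b01(1)]) auto
    then obtain x where AB: "p = 2" "q = 3" "A = {x, x + 8}" "B = {b0, b0 + 9}" by blast
    then have M: "M = 12" using assms(4) by simp
    have "spectral_pair (M\<^sup>2) {x, x + 8} {b0, b0 + 9}"
      unfolding M by (rule spectral_pair_two) auto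
    moreover have "translate_of A {0, 8}" "translate_of B {0, 9}"
      unfolding AB by (rule translate_of_pair)+
    ultimately show ?thesis using AB by simp
  qed
qed

end
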